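(* The argmin defining the class of greedy policies exists; that is, for every $n\in\{1,\dots,N\}$ and every posterior $p_{n-1}$ (arising from a history of $n-1$ questions and answers), the minimum over Borel sets $A\subset\mathbb R$ of $E[H(p_n)\mid p_{n-1},A_n=A]$ is attained. Under any greedy policy $\pi_G$, $$R(\pi_G,N)\ge H\left(\mathrm{Bin}\left(k,\tfrac12\right)\right).$$
   Context: Setting. $\log$ is the logarithm to base 2. Let $k\ge 1$, $N\ge1$ be integers. $\theta=(\theta_1,\dots,\theta_k)$ is a random vector in $\mathbb R^k$ whose coordinates are i.i.d. with Lebesgue density $f_0$ on $\mathbb R$, so $\theta$ has density $p_0(u)=\prod_{i=1}^k f_0(u_i)$; the differential entropy $H_0=H(p_0)$ is assumed finite, where for a density $p$ on $\mathbb R^k$, $H(p)=-\int_{\mathbb R^k} p(u)\log p(u)\,du$. $Z$ is uniform on $[0,1]$ and independent of $\theta$. Policies. A policy is a sequence $\pi=(\pi_1,\dots,\pi_N)$ where $\pi_n$ is a Borel subset of $[0,1]\times\{0,1,\dots,k\}^{n-1}\times\mathbb R$. Under $\pi$, the question sets and answers are defined recursively for $n=1,\dots,N$ by $A_n=\{t\in\mathbb R:(Z,X_1,\dots,X_{n-1},t)\in\pi_n\}$ and $X_n=\mathbb 1_{A_n}(\theta_1)+\dots+\mathbb 1_{A_n}(\theta_k)$. Posterior and rate. $p_n$ is the conditional (posterior) density of $\theta$ given the history $B_n=(Z,A_1,\dots,A_n,X_1,\dots,X_n)$ (with $B_0=Z$): $p_n(u)$ is proportional to $p_0(u)$ on the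 set $\{u\in\mathbb R^k: X_m=\sum_{i=1}^k\mathbb 1_{A_m}(u_i),\ 1\le m\le n\}$ (a set which has positive $p_0$-mass for histories that can arise) and is $0$ outside. The rate of reduction in expected entropy is $R(\pi,N)=\frac{H_0-E^\pi[H(p_N)]}{N}$. Greedy policy. $E[H(p_n)\mid p_{n-1},A_n=A]$ is the expected entropy of the next posterior when the current posterior is $p_{n-1}$ (so $\theta\sim p_{n-1}$) and the next question is the set $A$. A greedy policy is any policy whose questions satisfy, for all $n=1,\dots,N$, $A_n\in\arg\min_A E[H(p_n)\mid p_{n-1},A_n=A]$, the argmin being over all Borel subsets $A$ of $\mathbb R$. $H(\mathrm{Bin}(k,\frac12))$ is the discrete (Shannon, base 2) entropy of the Binomial distribution with parameters $k$ and $\frac12$. *)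

theory Defs
  imports "HOL-Probability.Probability"
begin

text \<open>
  Independence of two random variables with different value types, which the library's
  \<open>indep_var\<close> does not allow.
\<close>

definition indep_rvs ::
  "'a measure \<Rightarrow> 'b measure \<Rightarrow> ('a \<Rightarrow> 'b) \<Rightarrow> 'c measure \<Rightarrow> ('a \<Rightarrow> 'c) \<Rightarrow> bool" where
  "indep_rvs M S X T Y \<longleftrightarrow>
     X \<in> measurable M S \<and> Y \<in> measurable M T \<and>
     prob_space.indep_set M {X -` A \<inter> space M | A. A \<in> sets S} {Y -` B \<inter> space M | B. B \<in> sets T}"

text \<open>
  Points of \<open>\<real>\<^sup>k\<close> are functions \<open>u\<close> on the index set \<open>{..<k}\<close> (extensional outside it), with the
  product Lebesgue measure.
\<close>

definition lebesgue_Rk :: "nat \<Rightarrow> (nat \<Rightarrow> real) measure" where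
  "lebesgue_Rk k = (\<Pi>\<^sub>M i\<in>{..<k}. lborel)"

definition prior_density :: "nat \<Rightarrow> (real \<Rightarrow> real) \<Rightarrow> (nat \<Rightarrow> real) \<Rightarrow> real" where
  "prior_density k f0 u = (\<Prod>i<k. f0 (u i))"

text \<open>The convention \<open>0 * log 2 0 = 0\<close> holds automatically.\<close>

definition diff_entropy :: "nat \<Rightarrow> ((nat \<Rightarrow> real) \<Rightarrow> real) \<Rightarrow> real" where
  "diff_entropy k p = - (\<integral>u. p u * log 2 (p u) \<partial>lebesgue_Rk k)"

definition shannon_entropy :: "'a pmf \<Rightarrow> real" where
  "shannon_entropy p = - (\<Sum>\<^sub>\<infinity>x. pmf p x * log 2 (pmf p x))"

definition answer :: "nat \<Rightarrow> real set \<Rightarrow> (nat \<Rightarrow> real) \<Rightarrow> nat" where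
  "answer k A u = (\<Sum>i<k. indicator A (u i))"

text \<open>
  The density \<open>p\<close> conditioned on the event \<open>S\<close>; it is the zero function, rather than a density,
  when \<open>S\<close> has \<open>p\<close>-mass zero.
\<close>

definition cond_density ::
  "nat \<Rightarrow> ((nat \<Rightarrow> real) \<Rightarrow> real) \<Rightarrow> (nat \<Rightarrow> real) set \<Rightarrow> (nat \<Rightarrow> real) \<Rightarrow> real" where
  "cond_density k p S u = p u * indicator S u / (\<integral>v. p v * indicator S v \<partial>lebesgue_Rk k)"

text \<open>
  A history of \<open>n\<close> questions and answers is given by the values of \<open>A\<close> and \<open>x\<close> at \<open>1, \<dots>, n\<close>.
\<close>

definition consistent :: "nat \<Rightarrow> nat \<Rightarrow> (nat \<Rightarrow> real set) \<Rightarrow> (nat \<Rightarrow> nat) \<Rightarrow> (nat \<Rightarrow> real) set" where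
  "consistent k n A x = {u \<in> space (lebesgue_Rk k). \<forall>m\<in>{1..n}. x m = answer k (A m) u}"

definition posterior ::
  "nat \<Rightarrow> (real \<Rightarrow> real) \<Rightarrow> nat \<Rightarrow> (nat \<Rightarrow> real set) \<Rightarrow> (nat \<Rightarrow> nat) \<Rightarrow> (nat \<Rightarrow> real) \<Rightarrow> real" where
  "posterior k f0 n A x = cond_density k (prior_density k f0) (consistent k n A x)"

text \<open>
  With \<open>\<theta> \<sim> p\<close> and question \<open>A\<close>, the next posterior is \<open>p\<close> conditioned on
  \<open>{v. answer k A v = answer k A \<theta>}\<close>; its entropy is averaged over \<open>\<theta>\<close>.
\<close>

definition expected_next_entropy ::
  "nat \<Rightarrow> ((nat \<Rightarrow> real) \<Rightarrow> real) \<Rightarrow> real set \<Rightarrow> real" where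
  "expected_next_entropy k p A =
     (\<integral>\<theta>. diff_entropy k
            (cond_density k p {v \<in> space (lebesgue_Rk k). answer k A v = answer k A \<theta>})
        \<partial>density (lebesgue_Rk k) (\<lambda>u. ennreal (p u)))"

definition optimal_question :: "nat \<Rightarrow> ((nat \<Rightarrow> real) \<Rightarrow> real) \<Rightarrow> real set \<Rightarrow> bool" where
  "optimal_question k p A \<longleftrightarrow> is_arg_min (expected_next_entropy k p) (\<lambda>B. B \<in> sets borel) A"

text \<open>
  \<open>\<pi> n\<close> is a Borel subset of \<open>[0,1] \<times> {0,\<dots>,k}\<^bsup>n-1\<^esup> \<times> \<real>\<close>, the middle factor being indexed by
  \<open>1, \<dots>, n - 1\<close>.
\<close>

type_synonym policy = "nat \<Rightarrow> (real \<times> (nat \<Rightarrow> nat) \<times> real) set"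

definition is_policy :: "nat \<Rightarrow> nat \<Rightarrow> policy \<Rightarrow> bool" where
  "is_policy k N \<pi> \<longleftrightarrow>
     (\<forall>n\<in>{1..N}. \<pi> n \<in> sets (restrict_space borel {0..1} \<Otimes>\<^sub>M
        ((\<Pi>\<^sub>M m\<in>{1..<n}. count_space {0..k}) \<Otimes>\<^sub>M borel)))"

lemma restrict_fundef_cong [fundef_cong]:
  "I = J \<Longrightarrow> (\<And>i. i \<in> J \<Longrightarrow> f i = g i) \<Longrightarrow> restrict f I = restrict g J"
  by auto

text \<open>
  The answers \<open>X\<^sub>n\<close> and questions \<open>A\<^sub>n\<close> obtained from \<open>\<pi>\<close> when \<open>Z = z\<close> and \<open>\<theta> = u\<close>.
\<close>

fun policy_answer :: "nat \<Rightarrow> policy \<Rightarrow> real \<Rightarrow> (nat \<Rightarrow> real) \<Rightarrow> nat \<Rightarrow> nat" where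
  "policy_answer k \<pi> z u n =
     answer k {t. (z, (\<lambda>m\<in>{1..<n}. policy_answer k \<pi> z u m), t) \<in> \<pi> n} u"

declare policy_answer.simps [simp del]

definition policy_question ::
  "nat \<Rightarrow> policy \<Rightarrow> real \<Rightarrow> (nat \<Rightarrow> real) \<Rightarrow> nat \<Rightarrow> real set" where
  "policy_question k \<pi> z u n = {t. (z, (\<lambda>m\<in>{1..<n}. policy_answer k \<pi> z u m), t) \<in> \<pi> n}"

definition policy_posterior ::
  "nat \<Rightarrow> (real \<Rightarrow> real) \<Rightarrow> policy \<Rightarrow> nat \<Rightarrow> real \<Rightarrow> (nat \<Rightarrow> real) \<Rightarrow> (nat \<Rightarrow> real) \<Rightarrow> real" where
  "policy_posterior k f0 \<pi> n z u =
     posterior k f0 n (policy_question k \<pi> z u) (policy_answer k \<pi> z u)"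

text \<open>
  Posteriors are determined only up to null events, so greediness is required almost surely.
\<close>

definition greedy_policy ::
  "nat \<Rightarrow> nat \<Rightarrow> (real \<Rightarrow> real) \<Rightarrow> 'a measure \<Rightarrow> ('a \<Rightarrow> real) \<Rightarrow> ('a \<Rightarrow> nat \<Rightarrow> real) \<Rightarrow> policy \<Rightarrow> bool" where
  "greedy_policy k N f0 M Z \<theta> \<pi> \<longleftrightarrow> is_policy k N \<pi> \<and>
     (AE \<omega> in M. \<forall>n\<in>{1..N}.
        optimal_question k (policy_posterior k f0 \<pi> (n - 1) (Z \<omega>) (\<theta> \<omega>))
          (policy_question k \<pi> (Z \<omega>) (\<theta> \<omega>) n))"

definition reduction_rate ::
  "nat \<Rightarrow> nat \<Rightarrow> (real \<Rightarrow> real) \<Rightarrow> 'a measure \<Rightarrow> ('a \<Rightarrow> real) \<Rightarrow> ('a \<Rightarrow> nat \<Rightarrow> real) \<Rightarrow> policy \<Rightarrow> real" where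
  "reduction_rate k N f0 M Z \<theta> \<pi> =
     (diff_entropy k (prior_density k f0)
       - (\<integral>\<omega>. diff_entropy k (policy_posterior k f0 \<pi> N (Z \<omega>) (\<theta> \<omega>)) \<partial>M)) / real N"

end

theory Submission
  imports Defs "HOL-Real_Asymp.Real_Asymp"
begin

text \<open>
  Conditioning a density on the answer to a question lowers the expected entropy by exactly the
  Shannon entropy of the answer. Past questions cut \<open>\<real>\<close> into finitely many cells, and the law of
  the next answer depends only on the mass that the next question takes from each cell. Since the
  law of a coordinate has no atoms, these masses range over a whole compact box, on which the
  entropy of the answer is continuous, so that a best question exists. The question which halves
  every cell makes the answer binomial, whatever the history; hence a greedy question gains at
  least \<open>H(Bin(k, 1/2))\<close>, and the gains add up by the tower property for fixed \<open>Z\<close>.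
\<close>

section \<open>Entropy of a density conditioned on a finite partition\<close>

text \<open>A posterior is not a product density, because conditioning on counts couples the
  coordinates. But the event of a history is a finite disjoint union of boxes, one for each
  assignment of cells to coordinates that reproduces the past answers, and under the prior a box has
  product mass. Inside one box the coordinates remain independent, and a question that halves every
  cell catches each of them with probability 1/2. The count is thus binomial in every box, hence
  also in their mixture, whatever the masses of the boxes.

  For fixed \<open>Z\<close> a policy is a deterministic decision tree with finitely many histories,
  so all conditioning is on finite partitions of R^k and posterior densities can be handled by
  elementary averages. \<open>Z\<close> itself takes uncountably many values; it is integrated out
  by Fubini, which needs joint measurability in \<open>(z, u)\<close> and a bound on the mean
  absolute entropy that is uniform in \<open>z\<close>.\<close>

lemma space_lebesgue_Rk: "space (lebesgue_Rk k) = ({..<k} \<rightarrow>\<^sub>E UNIV)"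
  by (simp add: lebesgue_Rk_def space_PiM)

lemma sets_lebesgue_Rk: "sets (lebesgue_Rk k) = sets (\<Pi>\<^sub>M i\<in>{..<k}. borel)"
  unfolding lebesgue_Rk_def by (intro sets_PiM_cong) auto

lemma sigma_finite_lebesgue_Rk: "sigma_finite_measure (lebesgue_Rk k)"
proof -
  interpret product_sigma_finite "\<lambda>_::nat. lborel :: real measure" ..
  show ?thesis unfolding lebesgue_Rk_def by (rule sigma_finite) simp
qed

text \<open>Comes from \<open>ln y \<le> y - 1\<close> at \<open>y = 1 / r\<close>. The constant is
  not sharp, but any constant serves in the uniform bound on mean absolute entropies.\<close>

lemma abs_xlog2x_le:
  fixes r :: real
  assumes "0 \<le> r" "r \<le> 1"
  shows "\<bar>r * log 2 r\<bar> \<le> 1 / ln 2"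
proof (cases "r = 0")
  case False
  with assms have r: "0 < r" by simp
  have "ln (1 / r) \<le> 1 / r - 1" using r by (intro ln_le_minus_one) simp
  then have "r * (- ln r) \<le> r * (1 / r - 1)"
    using r by (intro mult_left_mono) (auto simp: ln_div)
  also have "\<dots> \<le> 1" using r by (simp add: field_simps)
  finally have "- (r * ln r) \<le> 1" by simp
  moreover have "r * ln r \<le> 0" using r assms by (simp add: mult_le_0_iff)
  ultimately have "\<bar>r * ln r\<bar> \<le> 1" by simp
  then show ?thesis by (simp add: log_def abs_mult divide_right_mono)
qed simp

text \<open>Zero has to be in the domain, since an answer may have probability zero. There the limit
  from the right agrees with the value \<open>0 * log 2 0 = 0\<close>.\<close>

lemma continuous_on_xlog2x: "continuous_on {0..} (\<lambda>x::real. x * log 2 x)"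
proof -
  have "((\<lambda>x::real. x * log 2 x) \<longlongrightarrow> 0) (at_right 0)" by real_asymp
  then have 0: "continuous (at 0 within {0..}) (\<lambda>x::real. x * log 2 x)"
    by (simp add: continuous_within at_within_Ici_at_right)
  have "continuous (at x within {0..}) (\<lambda>x::real. x * log 2 x)" if x: "x > 0" for x
  proof -
    have "isCont (\<lambda>x::real. x * log 2 x) x"
      using x unfolding log_def by (intro continuous_intros) auto
    then show ?thesis by (rule continuous_at_imp_continuous_at_within)
  qed
  moreover have "x = 0 \<or> x > 0" if "x \<in> {0..}" for x :: real using that by auto
  ultimately show ?thesis using 0 unfolding continuous_on_eq_continuous_within by blast
qed

text \<open>The integrand is a combination of the indicators of the fibres of \<open>g\<close>.
  Later \<open>F\<close> is the entropy of the density conditioned on a fibre, or its absolute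
  value.\<close>

lemma has_bochner_integral_finite_range:
  fixes F :: "'b \<Rightarrow> real"
  assumes "finite_measure Q" and g: "g \<in> measurable Q (count_space X)" and X: "finite X"
  shows "has_bochner_integral Q (\<lambda>u. F (g u)) (\<Sum>x\<in>X. F x * measure Q {u\<in>space Q. g u = x})"
proof -
  interpret finite_measure Q by fact
  have m: "{u\<in>space Q. g u = x} \<in> sets Q" if "x \<in> X" for x
  proof -
    have "g -` {x} \<inter> space Q \<in> sets Q" using that by (intro measurable_sets[OF g]) auto
    moreover have "g -` {x} \<inter> space Q = {u\<in>space Q. g u = x}" by auto
    ultimately show ?thesis by simp
  qed
  have "has_bochner_integral Q (\<lambda>u. \<Sum>x\<in>X. F x * indicator {u\<in>space Q. g u = x} u)
      (\<Sum>x\<in>X. F x * measure Q {u\<in>space Q. g u = x})"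
    using m by (intro has_bochner_integral_sum has_bochner_integral_mult_right has_bochner_integral_real_indicator)
      (auto simp: emeasure_eq_measure)
  then show ?thesis
  proof (rule has_bochner_integral_cong[THEN iffD1, rotated -1])
    fix u assume u: "u \<in> space Q"
    have "g u \<in> X" using measurable_space[OF g u] by simp
    then have "(\<Sum>x\<in>X. F x * indicator {u\<in>space Q. g u = x} u) = (\<Sum>x\<in>X. if x = g u then F x else 0)"
      using u by (intro sum.cong) (auto simp: indicator_def)
    also have "\<dots> = F (g u)" using \<open>g u \<in> X\<close> X by simp
    finally show "(\<Sum>x\<in>X. F x * indicator {u\<in>space Q. g u = x} u) = F (g u)" .
  qed auto
qed

text \<open>Null cells contribute nothing to the average, so the junk value \<open>x / 0 = 0\<close> is harmless.\<close>

lemma tower_finite_partition: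
  fixes \<phi> :: "'c \<Rightarrow> real"
  assumes "prob_space Q" and g: "g \<in> measurable Q (count_space X)" and X: "finite X"
    and \<phi>: "integrable Q \<phi>"
  shows "has_bochner_integral Q
     (\<lambda>u. (\<integral>v. indicator {v\<in>space Q. g v = g u} v * \<phi> v \<partial>Q) / measure Q {v\<in>space Q. g v = g u})
     (\<integral>v. \<phi> v \<partial>Q)"
proof -
  interpret prob_space Q by fact
  define C where "C x = {v\<in>space Q. g v = x}" for x
  have m: "C x \<in> sets Q" if "x \<in> X" for x
  proof -
    have "g -` {x} \<inter> space Q \<in> sets Q" using that by (intro measurable_sets[OF g]) auto
    moreover have "g -` {x} \<inter> space Q = C x" by (auto simp: C_def)
    ultimately show ?thesis by simp
  qed
  have int: "integrable Q (\<lambda>v. indicator (C x) v * \<phi> v)" if "x \<in> X" for x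
    using integrable_mult_indicator[OF m[OF that] \<phi>] by simp
  have null: "(\<integral>v. indicator (C x) v * \<phi> v \<partial>Q) = 0" if "x \<in> X" "measure Q (C x) = 0" for x
  proof -
    have "C x \<in> null_sets Q" using that m by (auto simp: null_sets_def emeasure_eq_measure)
    then have "AE v in Q. v \<notin> C x" by (rule AE_not_in)
    then show ?thesis using m[OF that(1)] \<phi> by (intro integral_eq_zero_AE) (auto simp: indicator_def)
  qed
  have "(\<integral>v. \<phi> v \<partial>Q) = (\<integral>v. (\<Sum>x\<in>X. indicator (C x) v * \<phi> v) \<partial>Q)"
  proof (rule Bochner_Integration.integral_cong)
    fix v assume v: "v \<in> space Q"
    have "g v \<in> X" using measurable_space[OF g v] by simp
    then show "\<phi> v = (\<Sum>x\<in>X. indicator (C x) v * \<phi> v)"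
      using v X by (simp add: C_def indicator_def sum_distrib_right[symmetric])
  qed simp
  also have "\<dots> = (\<Sum>x\<in>X. (\<integral>v. indicator (C x) v * \<phi> v \<partial>Q))"
    using int by (intro Bochner_Integration.integral_sum) auto
  also have "\<dots> = (\<Sum>x\<in>X. (\<integral>v. indicator (C x) v * \<phi> v \<partial>Q) / measure Q (C x) * measure Q (C x))"
    using null by (intro sum.cong) auto
  finally show ?thesis
    using has_bochner_integral_finite_range[OF finite_measure_axioms g X,
        of "\<lambda>x. (\<integral>v. indicator (C x) v * \<phi> v \<partial>Q) / measure Q (C x)"]
    by (simp add: C_def)
qed

text \<open>Instantiated with the prior and with every posterior of positive mass, so that the same
  identities serve the whole history and a single further question.\<close>

locale finite_entropy_density =
  fixes k :: nat and q :: "(nat \<Rightarrow> real) \<Rightarrow> real"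
  assumes q_measurable[measurable]: "q \<in> borel_measurable (lebesgue_Rk k)"
    and q_nonneg: "\<And>u. 0 \<le> q u"
    and prob_q: "prob_space (density (lebesgue_Rk k) (\<lambda>u. ennreal (q u)))"
    and entropy_integrable: "integrable (lebesgue_Rk k) (\<lambda>u. q u * log 2 (q u))"
begin

abbreviation "L \<equiv> lebesgue_Rk k"

definition "Q = density L (\<lambda>u. ennreal (q u))"

sublocale Q: prob_space Q
  unfolding Q_def by (rule prob_q)

lemma space_Q: "space Q = space L" and sets_Q[measurable_cong]: "sets Q = sets L"
  by (simp_all add: Q_def)

lemma integrable_q: "integrable L q"
proof -
  have "(\<integral>\<^sup>+u. ennreal (q u) \<partial>L) = 1"
    using Q.emeasure_space_1 by (simp add: Q_def emeasure_density cong: nn_integral_cong)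
  then show ?thesis by (intro integrableI_nonneg) (auto simp: q_nonneg)
qed

lemma integral_Q:
  fixes f :: "_ \<Rightarrow> real"
  assumes "f \<in> borel_measurable L"
  shows "(\<integral>u. f u \<partial>Q) = (\<integral>u. q u * f u \<partial>L)"
  unfolding Q_def using assms q_nonneg by (subst integral_density) auto

lemma integral_q_indicator:
  assumes [measurable]: "E \<in> sets L"
  shows "(\<integral>v. q v * indicator E v \<partial>L) = measure Q E"
proof -
  have "(\<integral>v. q v * indicator E v \<partial>L) = (\<integral>v. indicator E v \<partial>Q)"
    by (subst integral_Q) auto
  also have "\<dots> = measure Q (E \<inter> space Q)" by simp
  also have "E \<inter> space Q = E" using sets.sets_into_space[OF assms] by (auto simp: space_Q)
  finally show ?thesis .
qed

text \<open>There is no minus sign: this is the part of \<open>- diff_entropy k q\<close> that comes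
  from \<open>E\<close>. Unlike the entropies of the conditioned densities, it is additive over a
  partition.\<close>

definition local_entropy :: "(nat \<Rightarrow> real) set \<Rightarrow> real" where
  "local_entropy E = (\<integral>v. indicator E v * (q v * log 2 (q v)) \<partial>L)"

lemma integrable_local_entropy:
  assumes "E \<in> sets L"
  shows "integrable L (\<lambda>v. indicator E v * (q v * log 2 (q v)))"
  using integrable_mult_indicator[OF assms entropy_integrable] by simp

lemma null_q:
  assumes E: "E \<in> sets L" and 0: "measure Q E = 0"
  shows "AE v in L. indicator E v * q v = 0"
proof -
  have "E \<in> null_sets Q" using assms by (simp add: null_sets_def Q.emeasure_eq_measure sets_Q)
  then have "AE v in L. v \<in> E \<longrightarrow> ennreal (q v) = 0"
    unfolding Q_def by (subst (asm) null_sets_density_iff) auto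
  then show ?thesis by eventually_elim (use q_nonneg in \<open>auto simp: indicator_def ennreal_eq_0_iff intro: antisym\<close>)
qed

lemma local_entropy_null:
  assumes E: "E \<in> sets L" and "measure Q E = 0"
  shows "local_entropy E = 0"
  unfolding local_entropy_def
proof (rule integral_eq_zero_AE)
  show "AE v in L. indicator E v * (q v * log 2 (q v)) = 0"
    using null_q[OF assms] by eventually_elim auto
qed

text \<open>If \<open>E\<close> is a null set, both sides are \<open>0\<close>: the conditioned density is the zero function, and
  \<open>log 2 0 = 0\<close> and \<open>x / 0 = 0\<close> on the right.\<close>

lemma diff_entropy_cond:
  assumes E: "E \<in> sets L"
  shows "diff_entropy k (cond_density k q E) = log 2 (measure Q E) - local_entropy E / measure Q E"
proof (cases "measure Q E = 0")
  case True
  then show ?thesis using integral_q_indicator[OF E]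
    by (simp add: diff_entropy_def cond_density_def log_def)
next
  case False
  define c where "c = measure Q E"
  have c: "c > 0" using False by (simp add: c_def zero_less_measure_iff)
  have cd: "cond_density k q E u = q u * indicator E u / c" for u
    by (simp add: cond_density_def integral_q_indicator[OF E] c_def)
  have "cond_density k q E u * log 2 (cond_density k q E u)
     = indicator E u * (q u * log 2 (q u)) / c - (q u * indicator E u) * (log 2 c / c)" for u
  \<comment> \<open>The logarithm of the quotient splits only for \<open>q u > 0\<close>; in the
    other cases every term carries a factor zero.\<close>
  proof (cases "q u = 0 \<or> u \<notin> E")
    case False
    then have "q u > 0" using q_nonneg[of u] by auto
    with False c show ?thesis by (simp add: cd log_divide field_simps)
  qed (auto simp: cd)
  then have "diff_entropy k (cond_density k q E)
      = - (\<integral>u. indicator E u * (q u * log 2 (q u)) / c - (q u * indicator E u) * (log 2 c / c) \<partial>L)"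
    by (simp add: diff_entropy_def)
  also have "\<dots> = - ((\<integral>u. indicator E u * (q u * log 2 (q u)) / c \<partial>L) - (\<integral>u. (q u * indicator E u) * (log 2 c / c) \<partial>L))"
  proof (subst Bochner_Integration.integral_diff)
    show "integrable L (\<lambda>u. indicator E u * (q u * log 2 (q u)) / c)"
      using integrable_local_entropy[OF E] by simp
    show "integrable L (\<lambda>u. (q u * indicator E u) * (log 2 c / c))"
      using integrable_mult_indicator[OF E integrable_q]
      by (intro Bochner_Integration.integrable_mult_left) (simp add: mult.commute)
  qed simp
  also have "\<dots> = - (local_entropy E / c - c * (log 2 c / c))"
    by (simp add: local_entropy_def integral_q_indicator[OF E] c_def)
  finally show ?thesis using c by (simp add: c_def)
qed

text \<open>The indicators of the fibres sum to one, so they split both integrals. The second bound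
  does not involve \<open>g\<close> or \<open>X\<close>, which makes the later estimates uniform in
  \<open>z\<close>.\<close>

lemma sum_local_entropy:
  assumes g: "g \<in> measurable L (count_space X)" and X: "finite X"
  shows "(\<Sum>x\<in>X. local_entropy {v\<in>space L. g v = x}) = - diff_entropy k q"
    and "(\<Sum>x\<in>X. \<bar>local_entropy {v\<in>space L. g v = x}\<bar>) \<le> (\<integral>u. \<bar>q u * log 2 (q u)\<bar> \<partial>L)"
proof -
  define C where "C x = {v\<in>space L. g v = x}" for x
  have m: "C x \<in> sets L" if "x \<in> X" for x
  proof -
    have "g -` {x} \<inter> space L \<in> sets L" using that by (intro measurable_sets[OF g]) auto
    moreover have "g -` {x} \<inter> space L = C x" by (auto simp: C_def)
    ultimately show ?thesis by simp
  qed
  have dec: "f v = (\<Sum>x\<in>X. indicator (C x) v * f v)" if v: "v \<in> space L" for v and f :: "(nat \<Rightarrow> real) \<Rightarrow> real"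
  proof -
    have "g v \<in> X" using measurable_space[OF g v] by simp
    then show ?thesis
      using v X by (simp add: C_def indicator_def sum_distrib_right[symmetric])
  qed
  have "(\<Sum>x\<in>X. local_entropy (C x)) = (\<integral>v. (\<Sum>x\<in>X. indicator (C x) v * (q v * log 2 (q v))) \<partial>L)"
    unfolding local_entropy_def
    using integrable_local_entropy[OF m] by (intro Bochner_Integration.integral_sum[symmetric]) auto
  also have "\<dots> = (\<integral>v. q v * log 2 (q v) \<partial>L)"
    by (intro Bochner_Integration.integral_cong refl dec[symmetric])
  finally show "(\<Sum>x\<in>X. local_entropy {v\<in>space L. g v = x}) = - diff_entropy k q"
    by (simp add: C_def diff_entropy_def)
  have "(\<Sum>x\<in>X. \<bar>local_entropy (C x)\<bar>) \<le> (\<Sum>x\<in>X. (\<integral>v. indicator (C x) v * \<bar>q v * log 2 (q v)\<bar> \<partial>L))"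
  proof (rule sum_mono)
    fix x assume "x \<in> X"
    have "\<bar>local_entropy (C x)\<bar> \<le> (\<integral>v. \<bar>indicator (C x) v * (q v * log 2 (q v))\<bar> \<partial>L)"
      unfolding local_entropy_def by (rule integral_abs_bound)
    then show "\<bar>local_entropy (C x)\<bar> \<le> (\<integral>v. indicator (C x) v * \<bar>q v * log 2 (q v)\<bar> \<partial>L)"
      by (simp add: abs_mult)
  qed
  also have "\<dots> = (\<integral>v. (\<Sum>x\<in>X. indicator (C x) v * \<bar>q v * log 2 (q v)\<bar>) \<partial>L)"
  proof (intro Bochner_Integration.integral_sum[symmetric])
    fix x assume "x \<in> X"
    then show "integrable L (\<lambda>v. indicator (C x) v * \<bar>q v * log 2 (q v)\<bar>)"
      using integrable_mult_indicator[OF m integrable_abs[OF entropy_integrable]] by simp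
  qed
  also have "\<dots> = (\<integral>u. \<bar>q u * log 2 (q u)\<bar> \<partial>L)"
    by (intro Bochner_Integration.integral_cong refl dec[symmetric])
  finally show "(\<Sum>x\<in>X. \<bar>local_entropy {v\<in>space L. g v = x}\<bar>) \<le> (\<integral>u. \<bar>q u * log 2 (q u)\<bar> \<partial>L)"
    by (simp add: C_def)
qed

context
  fixes g :: "(nat \<Rightarrow> real) \<Rightarrow> 'x" and X :: "'x set"
  assumes g: "g \<in> measurable L (count_space X)" and X: "finite X"
begin

lemma fibre_sets: "x \<in> X \<Longrightarrow> {v\<in>space L. g v = x} \<in> sets L"
proof -
  assume "x \<in> X"
  then have "g -` {x} \<inter> space L \<in> sets L" by (intro measurable_sets[OF g]) auto
  moreover have "g -` {x} \<inter> space L = {v\<in>space L. g v = x}" by auto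
  ultimately show ?thesis by simp
qed

lemma g_measurable_Q: "g \<in> measurable Q (count_space X)"
  using g by (simp add: measurable_def sets_Q space_Q)

text \<open>Weighting the entropy of a fibre by its mass \<open>r\<close> cancels the denominators
  and leaves \<open>r * log 2 r\<close> minus the local entropy; the local entropies add up to
  \<open>- diff_entropy k q\<close>. This is the chain rule for a function \<open>g\<close> of the
  random point.\<close>

lemma mean_entropy_partition:
  "has_bochner_integral Q (\<lambda>u. diff_entropy k (cond_density k q {v\<in>space L. g v = g u}))
     (diff_entropy k q + (\<Sum>x\<in>X. measure Q {v\<in>space L. g v = x} * log 2 (measure Q {v\<in>space L. g v = x})))"
proof -
  let ?C = "\<lambda>x. {v\<in>space L. g v = x}"
  have "(\<Sum>x\<in>X. diff_entropy k (cond_density k q (?C x)) * measure Q (?C x))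
     = (\<Sum>x\<in>X. measure Q (?C x) * log 2 (measure Q (?C x)) - local_entropy (?C x))"
    by (intro sum.cong refl)
      (use fibre_sets local_entropy_null in \<open>auto simp: diff_entropy_cond field_simps\<close>)
  also have "\<dots> = diff_entropy k q + (\<Sum>x\<in>X. measure Q (?C x) * log 2 (measure Q (?C x)))"
    by (simp add: sum_subtractf sum_local_entropy(1)[OF g X])
  finally show ?thesis
    using has_bochner_integral_finite_range[OF Q.finite_measure_axioms g_measurable_Q X,
        of "\<lambda>x. diff_entropy k (cond_density k q (?C x))"]
    by (simp add: space_Q)
qed

text \<open>Beyond the density, the bound involves only the number of possible values. With
  \<open>g\<close> the history at a fixed \<open>z\<close> it is therefore uniform in
  \<open>z\<close>, as needed for Fubini.\<close>

lemma mean_abs_entropy_partition: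
  "(\<integral>u. \<bar>diff_entropy k (cond_density k q {v\<in>space L. g v = g u})\<bar> \<partial>Q)
     \<le> (\<integral>u. \<bar>q u * log 2 (q u)\<bar> \<partial>L) + card X / ln 2"
proof -
  let ?C = "\<lambda>x. {v\<in>space L. g v = x}"
  have "(\<integral>u. \<bar>diff_entropy k (cond_density k q {v\<in>space L. g v = g u})\<bar> \<partial>Q)
     = (\<Sum>x\<in>X. \<bar>diff_entropy k (cond_density k q (?C x))\<bar> * measure Q (?C x))"
    using has_bochner_integral_finite_range[OF Q.finite_measure_axioms g_measurable_Q X,
        of "\<lambda>x. \<bar>diff_entropy k (cond_density k q (?C x))\<bar>"]
    by (simp add: space_Q has_bochner_integral_iff)
  also have "\<dots> = (\<Sum>x\<in>X. \<bar>measure Q (?C x) * log 2 (measure Q (?C x)) - local_entropy (?C x)\<bar>)"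
  proof (intro sum.cong refl)
    fix x assume "x \<in> X"
    let ?r = "measure Q (?C x)"
    have "\<bar>diff_entropy k (cond_density k q (?C x))\<bar> * ?r = \<bar>diff_entropy k (cond_density k q (?C x)) * ?r\<bar>"
      by (simp add: abs_mult)
    also have "diff_entropy k (cond_density k q (?C x)) * ?r = ?r * log 2 ?r - local_entropy (?C x)"
      using fibre_sets[OF \<open>x \<in> X\<close>] local_entropy_null by (auto simp: diff_entropy_cond field_simps)
    finally show "\<bar>diff_entropy k (cond_density k q (?C x))\<bar> * ?r = \<bar>?r * log 2 ?r - local_entropy (?C x)\<bar>" .
  qed
  also have "\<dots> \<le> (\<Sum>x\<in>X. 1 / ln 2 + \<bar>local_entropy (?C x)\<bar>)"
  proof (rule sum_mono)
    fix x
    show "\<bar>measure Q (?C x) * log 2 (measure Q (?C x)) - local_entropy (?C x)\<bar> \<le> 1 / ln 2 + \<bar>local_entropy (?C x)\<bar>"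
      using abs_xlog2x_le[of "measure Q (?C x)"] by simp
  qed
  also have "\<dots> \<le> (\<integral>u. \<bar>q u * log 2 (q u)\<bar> \<partial>L) + card X / ln 2"
    using sum_local_entropy(2)[OF g X] by (simp add: sum.distrib)
  finally show ?thesis .
qed

end

end

section \<open>The information in one question\<close>

lemma shannon_entropy_binomial:
  assumes "0 \<le> p" "p \<le> 1"
  shows "shannon_entropy (binomial_pmf k p)
    = - (\<Sum>a\<le>k. pmf (binomial_pmf k p) a * log 2 (pmf (binomial_pmf k p) a))"
proof -
  have "pmf (binomial_pmf k p) a = 0" if "a \<notin> {..k}" for a
    using that assms by (simp add: binomial_eq_0)
  then have "(\<Sum>\<^sub>\<infinity>a. pmf (binomial_pmf k p) a * log 2 (pmf (binomial_pmf k p) a))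
     = (\<Sum>\<^sub>\<infinity>a\<in>{..k}. pmf (binomial_pmf k p) a * log 2 (pmf (binomial_pmf k p) a))"
    by (intro infsum_cong_neutral) auto
  then show ?thesis by (simp add: shannon_entropy_def)
qed

lemma binomial_half_pmf: "pmf (binomial_pmf k (1 / 2)) a = (k choose a) / 2 ^ k"
proof (cases "a \<le> k")
  case True
  have "pmf (binomial_pmf k (1 / 2)) a = (k choose a) * ((1 / 2) ^ a * (1 / 2) ^ (k - a))"
    by simp
  also have "(1 / 2 :: real) ^ a * (1 / 2) ^ (k - a) = 1 / 2 ^ k"
    using True by (simp add: power_add[symmetric] power_one_over del: power_divide)
  finally show ?thesis by simp
qed (simp add: binomial_eq_0)

text \<open>Points are null, so the distribution function of the measure restricted to
  \<open>C\<close> is continuous, and the intermediate value theorem cuts \<open>C\<close> by a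
  half-line at the required mass.\<close>

lemma exists_subset_of_measure:
  fixes f :: "real \<Rightarrow> real"
  assumes f[measurable]: "f \<in> borel_measurable borel"
    and prob: "prob_space (density lborel (\<lambda>x. ennreal (f x)))"
    and C[measurable]: "C \<in> sets borel"
    and v: "0 \<le> v" "v \<le> measure (density lborel (\<lambda>x. ennreal (f x))) C"
  shows "\<exists>D. D \<in> sets borel \<and> D \<subseteq> C \<and> measure (density lborel (\<lambda>x. ennreal (f x))) D = v"
proof -
  define \<mu> where "\<mu> = density lborel (\<lambda>x. ennreal (f x))"
  define \<nu> where "\<nu> = density \<mu> (indicator C)"
  interpret \<mu>: prob_space \<mu> using prob by (simp add: \<mu>_def)
  have sets_\<mu>[measurable_cong]: "sets \<mu> = sets borel" by (simp add: \<mu>_def)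
  have em: "emeasure \<nu> D = emeasure \<mu> (C \<inter> D)" if "D \<in> sets borel" for D
    unfolding \<nu>_def using that by (subst emeasure_density) (auto simp: sets_\<mu> indicator_inter_arith[symmetric])
  then have ms: "measure \<nu> D = measure \<mu> (C \<inter> D)" if "D \<in> sets borel" for D
    using that by (simp add: measure_def)
  interpret \<nu>: finite_borel_measure \<nu>
  proof (intro finite_borel_measure.intro finite_borel_measure_axioms.intro finite_measureI)
    have "emeasure \<nu> (space \<nu>) = emeasure \<mu> (C \<inter> UNIV)"
      using em[of UNIV] by (simp add: \<nu>_def \<mu>_def)
    then show "emeasure \<nu> (space \<nu>) \<noteq> \<infinity>" by simp
    show "sets \<nu> = sets borel" by (simp add: \<nu>_def sets_\<mu>)
  qed
  have "emeasure \<mu> {x} = 0" for x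
  proof -
    have "{x} \<in> null_sets lborel" by (simp add: null_sets_def)
    then have "AE y in lborel. y \<notin> {x}" by (rule AE_not_in)
    then have "AE y in lborel. y \<in> {x} \<longrightarrow> ennreal (f y) = 0" by eventually_elim auto
    then have "{x} \<in> null_sets \<mu>" unfolding \<mu>_def by (subst null_sets_density_iff) auto
    then show ?thesis by auto
  qed
  then have "measure \<mu> {x} = 0" for x by (simp add: measure_def)
  then have "measure \<nu> {x} = 0" for x
    using \<mu>.finite_measure_mono[of "C \<inter> {x}" "{x}"] measure_nonneg[of \<mu> "C \<inter> {x}"]
    by (simp add: ms sets_\<mu> del: measure_nonneg)
  then have cont: "isCont (cdf \<nu>) x" for x by (simp add: \<nu>.isCont_cdf)
  have cdf: "cdf \<nu> x = measure \<mu> (C \<inter> {..x})" for x by (simp add: cdf_def ms)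
  \<comment> \<open>The two extreme values are limits of the distribution function that it need not
    attain, so they get their own witnesses.\<close>
  consider "v = 0" | "v = measure \<mu> C" | "0 < v" "v < measure \<mu> C"
    using v by (fastforce simp: \<mu>_def)
  then have "\<exists>D. D \<in> sets borel \<and> D \<subseteq> C \<and> measure \<mu> D = v"
  proof cases
    case 1
    then show ?thesis by (intro exI[of _ "{}"]) auto
  next
    case 2
    then show ?thesis using C by blast
  next
    case 3
    have "measure \<nu> (space \<nu>) = measure \<mu> C"
      using ms[of UNIV] by (simp add: \<nu>_def \<mu>_def)
    then have "eventually (\<lambda>x. cdf \<nu> x > v) at_top"
      using order_tendstoD(1)[OF \<nu>.cdf_lim_at_top] 3 by simp
    then obtain b where b: "\<And>x. x \<ge> b \<Longrightarrow> cdf \<nu> x > v" by (auto simp: eventually_at_top_linorder)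
    have "eventually (\<lambda>x. cdf \<nu> x < v) at_bot"
      using order_tendstoD(2)[OF \<nu>.cdf_lim_at_bot] 3 by simp
    then obtain a where a: "\<And>x. x \<le> a \<Longrightarrow> cdf \<nu> x < v" by (auto simp: eventually_at_bot_linorder)
    \<comment> \<open>Taking \<open>min a b\<close> as the left end makes the interval nonempty
      without comparing \<open>a\<close> and \<open>b\<close>.\<close>
    have "\<exists>x. min a b \<le> x \<and> x \<le> b \<and> cdf \<nu> x = v"
      using a[of "min a b"] b[of b] cont by (intro IVT) auto
    then obtain x where "cdf \<nu> x = v" by blast
    then show ?thesis by (intro exI[of _ "C \<inter> {..x}"]) (auto simp: cdf)
  qed
  then show ?thesis by (simp add: \<mu>_def)
qed

text \<open>Tychonoff's theorem. Mass vectors will be indexed by all of \<open>nat set\<close>, an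
  infinite type, so the box is compact in the product topology rather than by a Heine-Borel
  argument.\<close>

lemma compact_product_Icc: "compact {y :: 'i \<Rightarrow> real. \<forall>i. y i \<in> {a i..b i}}"
proof -
  have "compactin (product_topology (\<lambda>_::'i. euclidean :: real topology) UNIV) (\<Pi>\<^sub>E i\<in>UNIV. {a i..b i})"
    by (simp add: compactin_PiE)
  moreover have "(\<Pi>\<^sub>E i\<in>UNIV. {a i..b i}) = {y. \<forall>i. y i \<in> {a i..b i}}" by auto
  ultimately show ?thesis by (simp only: euclidean_product_topology compactin_euclidean_iff)
qed

lemma answer_eq_card: "answer k B u = card {i\<in>{..<k}. u i \<in> B}"
  by (simp add: answer_def indicator_def sum.If_cases) (rule arg_cong[of _ _ card], auto)

lemma answer_le: "answer k B u \<le> k"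
proof -
  have "card {i\<in>{..<k}. u i \<in> B} \<le> card {..<k}" by (intro card_mono) auto
  then show ?thesis by (simp add: answer_eq_card)
qed

lemma measurable_answer:
  assumes [measurable]: "B \<in> sets borel"
  shows "answer k B \<in> measurable (lebesgue_Rk k) (count_space {0..k})"
proof -
  have "answer k B \<in> measurable (lebesgue_Rk k) (count_space UNIV)"
    unfolding answer_def[abs_def] indicator_def lebesgue_Rk_def by measurable
  then show ?thesis by (rule measurable_count_space_extend[rotated 2]) (auto simp: answer_le)
qed

section \<open>The product prior and its posteriors\<close>

locale iid_prior =
  fixes k :: nat and f0 :: "real \<Rightarrow> real"
  assumes f0_measurable[measurable]: "f0 \<in> borel_measurable borel"
    and f0_nonneg: "\<And>x. f0 x \<ge> 0"
    and prob_f0: "prob_space (density lborel (\<lambda>x. ennreal (f0 x)))"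
    and prior_entropy: "integrable (lebesgue_Rk k) (\<lambda>u. prior_density k f0 u * log 2 (prior_density k f0 u))"
begin

definition "\<mu> = density lborel (\<lambda>x. ennreal (f0 x))"

sublocale \<mu>: prob_space \<mu>
  unfolding \<mu>_def by (rule prob_f0)

lemma sets_\<mu>[measurable_cong]: "sets \<mu> = sets borel" by (simp add: \<mu>_def)

lemma measurable_prior_density: "prior_density k f0 \<in> borel_measurable (lebesgue_Rk k)"
  unfolding prior_density_def[abs_def] lebesgue_Rk_def by measurable

text \<open>A product measure is determined by its values on rectangles; there both the density and
  the indicator factor over the coordinates, and so does the integral.\<close>

lemma density_prior_eq_PiM: "density (lebesgue_Rk k) (\<lambda>u. ennreal (prior_density k f0 u)) = (\<Pi>\<^sub>M i\<in>{..<k}. \<mu>)"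
proof -
  interpret M: product_sigma_finite "\<lambda>_::nat. \<mu>" ..
  interpret B: product_sigma_finite "\<lambda>_::nat. lborel :: real measure" ..
  show ?thesis
  proof (rule M.PiM_eqI)
    show "sets (density (lebesgue_Rk k) (\<lambda>u. ennreal (prior_density k f0 u))) = sets (\<Pi>\<^sub>M i\<in>{..<k}. \<mu>)"
      unfolding lebesgue_Rk_def by (auto simp: sets_\<mu> intro!: sets_PiM_cong)
    fix A :: "nat \<Rightarrow> real set" assume "\<And>i. i \<in> {..<k} \<Longrightarrow> A i \<in> sets \<mu>"
    then have A[measurable]: "\<And>i. i \<in> {..<k} \<Longrightarrow> A i \<in> sets borel" by (simp add: sets_\<mu>)
    have PA: "Pi\<^sub>E {..<k} A \<in> sets (lebesgue_Rk k)"
      unfolding lebesgue_Rk_def using A by (intro sets_PiM_I_finite) auto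
    have "emeasure (density (lebesgue_Rk k) (\<lambda>u. ennreal (prior_density k f0 u))) (Pi\<^sub>E {..<k} A)
       = (\<integral>\<^sup>+u. ennreal (prior_density k f0 u) * indicator (Pi\<^sub>E {..<k} A) u \<partial>lebesgue_Rk k)"
      using measurable_prior_density PA by (intro emeasure_density) auto
    also have "\<dots> = (\<integral>\<^sup>+u. (\<Prod>i<k. ennreal (f0 (u i)) * indicator (A i) (u i)) \<partial>lebesgue_Rk k)"
    proof (intro nn_integral_cong)
      fix u assume u: "u \<in> space (lebesgue_Rk k)"
      have "indicator (Pi\<^sub>E {..<k} A) u = (\<Prod>i<k. indicator (A i) (u i) :: ennreal)"
      proof (cases "u \<in> Pi\<^sub>E {..<k} A")
        case True
        then have "(\<Prod>i<k. indicator (A i) (u i) :: ennreal) = 1"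
            by (intro prod.neutral ballI) (simp add: PiE_mem)
        then show ?thesis using True by simp
      next
        case False
        then obtain i where "i < k" "u i \<notin> A i" using u by (auto simp: space_lebesgue_Rk PiE_iff)
        then have "(\<Prod>i<k. indicator (A i) (u i) :: ennreal) = 0" by (intro prod_zero) (auto simp: indicator_def)
        then show ?thesis using False by simp
      qed
      then show "ennreal (prior_density k f0 u) * indicator (Pi\<^sub>E {..<k} A) u
         = (\<Prod>i<k. ennreal (f0 (u i)) * indicator (A i) (u i))"
        by (simp add: prod.distrib prior_density_def prod_ennreal f0_nonneg)
    qed
    also have "\<dots> = (\<Prod>i<k. \<integral>\<^sup>+t. ennreal (f0 t) * indicator (A i) t \<partial>lborel)"
      unfolding lebesgue_Rk_def using A by (intro B.product_nn_integral_prod) auto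
    also have "\<dots> = (\<Prod>i<k. emeasure \<mu> (A i))"
      unfolding \<mu>_def using A by (intro prod.cong refl) (auto simp: emeasure_density)
    finally show "emeasure (density (lebesgue_Rk k) (\<lambda>u. ennreal (prior_density k f0 u))) (Pi\<^sub>E {..<k} A)
       = (\<Prod>i<k. emeasure \<mu> (A i))" .
  qed simp
qed

sublocale finite_entropy_density k "prior_density k f0"
proof (rule finite_entropy_density.intro)
  show "prob_space (density (lebesgue_Rk k) (\<lambda>u. ennreal (prior_density k f0 u)))"
    unfolding density_prior_eq_PiM by (intro prob_space_PiM \<mu>.prob_space_axioms)
  show "0 \<le> prior_density k f0 u" for u by (simp add: prior_density_def f0_nonneg prod_nonneg)
qed (rule measurable_prior_density prior_entropy)+

lemma Q_eq_PiM: "Q = (\<Pi>\<^sub>M i\<in>{..<k}. \<mu>)"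
  unfolding Q_def by (rule density_prior_eq_PiM)

lemma box_sets: "(\<And>i. i < k \<Longrightarrow> A i \<in> sets borel) \<Longrightarrow> Pi\<^sub>E {..<k} A \<in> sets L"
  unfolding lebesgue_Rk_def by (intro sets_PiM_I_finite) auto

lemma measure_box:
  assumes A: "\<And>i. i < k \<Longrightarrow> A i \<in> sets borel"
  shows "measure Q (Pi\<^sub>E {..<k} A) = (\<Prod>i<k. measure \<mu> (A i))"
proof -
  interpret M: product_sigma_finite "\<lambda>_::nat. \<mu>" ..
  have "emeasure Q (Pi\<^sub>E {..<k} A) = (\<Prod>i<k. emeasure \<mu> (A i))"
    unfolding Q_eq_PiM using A by (intro M.emeasure_PiM) (auto simp: sets_\<mu>)
  then show ?thesis
    by (simp add: \<mu>.emeasure_eq_measure Q.emeasure_eq_measure prod_ennreal prod_nonneg)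
qed

lemma consistent_sets:
  assumes A: "\<And>m. m \<in> {1..n} \<Longrightarrow> A m \<in> sets borel"
  shows "consistent k n A x \<in> sets L"
proof -
  have "consistent k n A x = {u\<in>space L. \<forall>m\<in>{1..n}. answer k (A m) u \<in> {x m}}"
    unfolding consistent_def by auto
  also have "\<dots> \<in> sets L"
  proof (intro sets.sets_Collect_finite_All)
    fix m assume "m \<in> {1..n}"
    \<comment> \<open>The number \<open>x m\<close> may exceed \<open>k\<close>, so the singleton is
      first cut down to a subset of \<open>{0..k}\<close>.\<close>
    then have "answer k (A m) -` ({x m} \<inter> {0..k}) \<inter> space L \<in> sets L"
      using measurable_answer[OF A] by (intro measurable_sets) auto
    moreover have "answer k (A m) -` ({x m} \<inter> {0..k}) \<inter> space L = {u\<in>space L. answer k (A m) u \<in> {x m}}"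
      by (auto; metis answer_le)
    ultimately show "{u\<in>space L. answer k (A m) u \<in> {x m}} \<in> sets L" by simp
  qed auto
  finally show ?thesis .
qed

text \<open>Dividing by the mass \<open>c\<close> changes the entropy integrand on the event only by
  the factor \<open>1 / c\<close> and by a multiple of the density; both parts are
  integrable.\<close>

lemma posterior_density:
  fixes n A x
  defines "S \<equiv> consistent k n A x"
  assumes A: "\<And>m. m \<in> {1..n} \<Longrightarrow> A m \<in> sets borel" and pos: "measure Q S > 0"
  shows "finite_entropy_density k (posterior k f0 n A x)"
    and "\<And>E. E \<in> sets L \<Longrightarrow> measure (density L (\<lambda>u. ennreal (posterior k f0 n A x u))) E = measure Q (S \<inter> E) / measure Q S"
proof -
  let ?q = "posterior k f0 n A x"
  define c where "c = measure Q S"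
  have c: "c > 0" using pos by (simp add: c_def)
  have S[measurable]: "S \<in> sets L" unfolding S_def using A by (rule consistent_sets)
  have q: "?q u = prior_density k f0 u * indicator S u / c" for u
    unfolding posterior_def cond_density_def S_def[symmetric] c_def by (simp add: integral_q_indicator[OF S])
  have [measurable]: "?q \<in> borel_measurable L" unfolding q by measurable
  have q_nn: "?q u \<ge> 0" for u using c q_nonneg[of u] by (simp add: q)
  have em: "emeasure (density L (\<lambda>u. ennreal (?q u))) E = measure Q (S \<inter> E) / c" if [measurable]: "E \<in> sets L" for E
  proof -
    have "emeasure (density L (\<lambda>u. ennreal (?q u))) E = (\<integral>\<^sup>+u. ennreal (prior_density k f0 u) * indicator (S \<inter> E) u * ennreal (1 / c) \<partial>L)"
      using c q_nonneg
      by (subst emeasure_density)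
        (auto intro!: nn_integral_cong simp: q indicator_def divide_ennreal_def ennreal_mult[symmetric] divide_inverse)
    also have "\<dots> = (\<integral>\<^sup>+u. ennreal (prior_density k f0 u) * indicator (S \<inter> E) u \<partial>L) * ennreal (1 / c)"
      by (intro nn_integral_multc) auto
    also have "(\<integral>\<^sup>+u. ennreal (prior_density k f0 u) * indicator (S \<inter> E) u \<partial>L) = emeasure Q (S \<inter> E)"
      unfolding Q_def by (intro emeasure_density[symmetric]) auto
    finally show ?thesis using c by (simp add: Q.emeasure_eq_measure ennreal_mult[symmetric])
  qed
  show "measure (density L (\<lambda>u. ennreal (?q u))) E = measure Q (S \<inter> E) / measure Q S" if "E \<in> sets L" for E
    using em[OF that] c by (simp add: measure_def[of "density L _"] c_def)
  have "?q u * log 2 (?q u) = indicator S u * (prior_density k f0 u * log 2 (prior_density k f0 u)) / c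
      - indicator S u * prior_density k f0 u * (log 2 c / c)" for u
  proof (cases "prior_density k f0 u = 0 \<or> u \<notin> S")
    case False
    then have "prior_density k f0 u > 0" using q_nonneg[of u] by auto
    with False c show ?thesis by (simp add: q log_divide field_simps)
  qed (auto simp: q)
  moreover have "integrable L (\<lambda>u. indicator S u * (prior_density k f0 u * log 2 (prior_density k f0 u)) / c
      - indicator S u * prior_density k f0 u * (log 2 c / c))"
    using integrable_local_entropy[OF S] integrable_mult_indicator[OF S integrable_q]
    by (intro Bochner_Integration.integrable_diff Bochner_Integration.integrable_mult_left Bochner_Integration.integrable_divide_zero) auto
  ultimately have "integrable L (\<lambda>u. ?q u * log 2 (?q u))" by presburger
  moreover have "prob_space (density L (\<lambda>u. ennreal (?q u)))"
  proof
    have "S \<inter> space L = S" using sets.sets_into_space[OF S] by auto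
    then show "emeasure (density L (\<lambda>u. ennreal (?q u))) (space (density L (\<lambda>u. ennreal (?q u)))) = 1"
      using em[of "space L"] c by (simp add: c_def)
  qed
  ultimately show "finite_entropy_density k ?q"
    by (intro finite_entropy_density.intro q_nn) simp_all
qed

text \<open>\<open>mean_entropy_partition\<close> for the posterior, with the answer as the
  partitioning function. The probabilities are rewritten as ratios of prior masses, because only the
  prior gives boxes a product mass.\<close>

lemma expected_next_entropy_posterior:
  fixes n A x
  defines "S \<equiv> consistent k n A x"
  assumes A: "\<And>m. m \<in> {1..n} \<Longrightarrow> A m \<in> sets borel" and pos: "measure Q S > 0" and B: "B \<in> sets borel"
  shows "expected_next_entropy k (posterior k f0 n A x) B = diff_entropy k (posterior k f0 n A x)
    + (\<Sum>a\<le>k. (measure Q {u\<in>S. answer k B u = a} / measure Q S) * log 2 (measure Q {u\<in>S. answer k B u = a} / measure Q S))"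
proof -
  interpret p: finite_entropy_density k "posterior k f0 n A x"
    using A pos unfolding S_def by (rule posterior_density)
  have S: "S \<in> sets L" unfolding S_def using A by (rule consistent_sets)
  have "measure p.Q {v \<in> space L. answer k B v = a} = measure Q {u\<in>S. answer k B u = a} / measure Q S" if "a \<in> {0..k}" for a
  proof -
    have "S \<inter> {v \<in> space L. answer k B v = a} = {u\<in>S. answer k B u = a}"
      using sets.sets_into_space[OF S] by auto
    then show ?thesis
      unfolding p.Q_def S_def
      using posterior_density(2)[OF A pos[unfolded S_def] fibre_sets[OF measurable_answer[OF B] _ that]] by simp
  qed
  then have "(\<Sum>a\<in>{0..k}. measure p.Q {v \<in> space L. answer k B v = a} * log 2 (measure p.Q {v \<in> space L. answer k B v = a}))
     = (\<Sum>a\<le>k. (measure Q {u\<in>S. answer k B u = a} / measure Q S) * log 2 (measure Q {u\<in>S. answer k B u = a} / measure Q S))"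
    by (intro sum.cong) auto
  moreover have "expected_next_entropy k (posterior k f0 n A x) B
     = (\<integral>u. diff_entropy k (cond_density k (posterior k f0 n A x) {v\<in>space L. answer k B v = answer k B u}) \<partial>p.Q)"
    unfolding expected_next_entropy_def p.Q_def ..
  ultimately show ?thesis
    using has_bochner_integral_integral_eq[OF p.mean_entropy_partition[OF measurable_answer[OF B]]] by simp
qed

section \<open>Cells of the past questions and the law of the next answer\<close>

context
  fixes n :: nat and A :: "nat \<Rightarrow> real set" and x :: "nat \<Rightarrow> nat"
  assumes A: "\<And>m. m \<in> {1..n} \<Longrightarrow> A m \<in> sets borel"
begin

text \<open>\<open>cell s\<close> is the atom of the partition of \<open>\<real>\<close> generated by \<open>A 1, \<dots>, A n\<close> on which exactly the
  questions with index in \<open>s\<close> are answered affirmatively.\<close>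

definition cell :: "nat set \<Rightarrow> real set" where
  "cell s = {t. {m\<in>{1..n}. t \<in> A m} = s}"

lemma cell_borel: "cell s \<in> sets borel"
proof (cases "s \<subseteq> {1..n}")
  case True
  then have "cell s = {t\<in>space borel. \<forall>m\<in>{1..n}. t \<in> (if m \<in> s then A m else - A m)}"
    by (auto simp: cell_def split: if_splits)
  also have "\<dots> \<in> sets borel"
  proof (intro sets.sets_Collect_finite_All)
    fix m assume "m \<in> {1..n}"
    then have "(if m \<in> s then A m else - A m) \<in> sets borel" using A by (auto intro: borel_comp)
    then show "{t\<in>space borel. t \<in> (if m \<in> s then A m else - A m)} \<in> sets borel" by simp
  qed simp
  finally show ?thesis .
next
  case False
  then have "cell s = {}" by (auto simp: cell_def)
  then show ?thesis by simp
qed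

lemma cell_empty: "\<not> s \<subseteq> {1..n} \<Longrightarrow> cell s = {}"
  by (auto simp: cell_def)

text \<open>The assignments of cells to coordinates that reproduce the recorded answers:
  \<open>m \<in> s i\<close> says that coordinate \<open>i\<close> lies in \<open>A m\<close>.
  Extensionality makes the pattern of a point unique.\<close>

definition patterns :: "(nat \<Rightarrow> nat set) set" where
  "patterns = {s \<in> {..<k} \<rightarrow>\<^sub>E Pow {1..n}. \<forall>m\<in>{1..n}. x m = card {i\<in>{..<k}. m \<in> s i}}"

lemma finite_patterns: "finite patterns"
  unfolding patterns_def by (intro finite_Collect_conjI disjI1) (simp add: finite_PiE)

text \<open>In a pattern, \<open>s i\<close> tells the cell of the \<open>i\<close>-th coordinate, and \<open>J\<close> tells which coordinates lie
  in the new question \<open>B\<close>.\<close>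

definition pattern_box :: "real set \<Rightarrow> (nat \<Rightarrow> nat set) \<times> nat set \<Rightarrow> (nat \<Rightarrow> real) set" where
  "pattern_box B = (\<lambda>(s, J). Pi\<^sub>E {..<k} (\<lambda>i. if i \<in> J then cell (s i) \<inter> B else cell (s i) - B))"

text \<open>Both \<open>s\<close> and \<open>J\<close> can be read off from any point of the box, so
  distinct pairs give disjoint boxes.\<close>

lemma pattern_box_iff:
  assumes "s \<in> patterns" "J \<subseteq> {..<k}"
  shows "u \<in> pattern_box B (s, J) \<longleftrightarrow> u \<in> space L \<and>
     s = (\<lambda>i\<in>{..<k}. {m\<in>{1..n}. u i \<in> A m}) \<and> J = {i\<in>{..<k}. u i \<in> B}"
proof -
  have "s \<in> extensional {..<k}" using assms by (auto simp: patterns_def PiE_def)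
  then have s: "s = (\<lambda>i\<in>{..<k}. {m\<in>{1..n}. u i \<in> A m}) \<longleftrightarrow> (\<forall>i<k. s i = {m\<in>{1..n}. u i \<in> A m})"
    by (auto simp: fun_eq_iff extensional_def restrict_def)
  show ?thesis unfolding s using assms(2)
    by (auto simp: pattern_box_def PiE_iff space_lebesgue_Rk cell_def split: if_splits)
qed

lemma answer_event_eq:
  "{u \<in> consistent k n A x. answer k B u = a}
     = (\<Union>w\<in>patterns \<times> {J. J \<subseteq> {..<k} \<and> card J = a}. pattern_box B w)" (is "?l = ?r")
proof (intro set_eqI iffI)
  fix u assume u: "u \<in> ?l"
  let ?s = "\<lambda>i\<in>{..<k}. {m\<in>{1..n}. u i \<in> A m}" and ?J = "{i\<in>{..<k}. u i \<in> B}"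
  have "x m = card {i\<in>{..<k}. m \<in> ?s i}" if "m \<in> {1..n}" for m
  proof -
    have "{i\<in>{..<k}. m \<in> ?s i} = {i\<in>{..<k}. u i \<in> A m}" using that by auto
    then show ?thesis using u that by (auto simp: consistent_def answer_eq_card)
  qed
  then have s: "?s \<in> patterns" by (auto simp: patterns_def)
  have "u \<in> pattern_box B (?s, ?J)"
    using pattern_box_iff[OF s, of ?J u B] u by (auto simp: consistent_def)
  moreover have "card ?J = a" using u by (simp add: answer_eq_card)
  ultimately show "u \<in> ?r" using s by (intro UN_I[of "(?s, ?J)"]) auto
next
  fix u assume "u \<in> ?r"
  then obtain s J where sJ: "s \<in> patterns" "J \<subseteq> {..<k}" "card J = a" "u \<in> pattern_box B (s, J)" by auto
  then have u: "u \<in> space L" and s: "s = (\<lambda>i\<in>{..<k}. {m\<in>{1..n}. u i \<in> A m})" and J: "J = {i\<in>{..<k}. u i \<in> B}"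
    by (auto simp: pattern_box_iff)
  have "x m = answer k (A m) u" if "m \<in> {1..n}" for m
  proof -
    have "{i\<in>{..<k}. m \<in> s i} = {i\<in>{..<k}. u i \<in> A m}" using that by (auto simp: s)
    moreover have "x m = card {i\<in>{..<k}. m \<in> s i}" using sJ(1) that by (simp add: patterns_def)
    ultimately show ?thesis by (simp add: answer_eq_card)
  qed
  then show "u \<in> ?l" using u sJ(3) J by (auto simp: consistent_def answer_eq_card)
qed

text \<open>The joint mass of the history and the next answer \<open>a\<close>, as a polynomial in the masses
  \<open>y s = \<mu> (cell s \<inter> B)\<close>. Depending on \<open>B\<close> only through \<open>y\<close>, it reduces the optimization over all
  Borel sets to a compact box.\<close>

definition answer_prob :: "(nat set \<Rightarrow> real) \<Rightarrow> nat \<Rightarrow> real" where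
  "answer_prob y a = (\<Sum>s\<in>patterns. \<Sum>J | J \<subseteq> {..<k} \<and> card J = a.
      \<Prod>i<k. if i \<in> J then y (s i) else measure \<mu> (cell (s i)) - y (s i))"

lemma measure_answer_event:
  assumes B: "B \<in> sets borel"
  shows "measure Q {u \<in> consistent k n A x. answer k B u = a} = answer_prob (\<lambda>s. measure \<mu> (cell s \<inter> B)) a"
proof -
  let ?W = "patterns \<times> {J. J \<subseteq> {..<k} \<and> card J = a}"
  have fin: "finite ?W" using finite_patterns by auto
  have sets: "pattern_box B w \<in> sets L" for w
    unfolding pattern_box_def using B cell_borel by (auto split: prod.split intro!: box_sets)
  have disj: "disjoint_family_on (pattern_box B) ?W"
    unfolding disjoint_family_on_def by (auto simp: pattern_box_iff)
  have "measure Q (\<Union>w\<in>?W. pattern_box B w) = (\<Sum>w\<in>?W. measure Q (pattern_box B w))"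
    using fin sets disj by (intro Q.finite_measure_finite_Union) (auto simp: sets_Q)
  also have "\<dots> = (\<Sum>(s, J)\<in>?W. \<Prod>i<k. if i \<in> J then measure \<mu> (cell (s i) \<inter> B)
      else measure \<mu> (cell (s i)) - measure \<mu> (cell (s i) \<inter> B))"
  proof (intro sum.cong refl, clarify)
    fix s J
    have "measure Q (pattern_box B (s, J)) = (\<Prod>i<k. measure \<mu> (if i \<in> J then cell (s i) \<inter> B else cell (s i) - B))"
      unfolding pattern_box_def using B cell_borel by (auto intro!: measure_box)
    also have "\<dots> = (\<Prod>i<k. if i \<in> J then measure \<mu> (cell (s i) \<inter> B)
      else measure \<mu> (cell (s i)) - measure \<mu> (cell (s i) \<inter> B))"
      using B cell_borel by (intro prod.cong refl) (auto simp: \<mu>.finite_measure_Diff' sets_\<mu>)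
    finally show "measure Q (pattern_box B (s, J)) = \<dots>" .
  qed
  also have "\<dots> = answer_prob (\<lambda>s. measure \<mu> (cell s \<inter> B)) a"
    by (simp add: answer_prob_def sum.cartesian_product)
  finally show ?thesis by (simp add: answer_event_eq)
qed

text \<open>The empty question is always answered by 0, so the history is a special answer event,
  with all masses \<open>y s\<close> zero and \<open>J = {}\<close> as the only choice.\<close>

lemma measure_consistent: "measure Q (consistent k n A x) = (\<Sum>s\<in>patterns. \<Prod>i<k. measure \<mu> (cell (s i)))"
proof -
  have "{u \<in> consistent k n A x. answer k {} u = 0} = consistent k n A x"
    by (simp add: answer_eq_card)
  then have "measure Q (consistent k n A x) = answer_prob (\<lambda>s. 0) 0"
    using measure_answer_event[OF sets.empty_sets, of 0] by (simp only: Int_empty_right measure_empty)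
  moreover have "{J. J \<subseteq> {..<k} \<and> card J = 0} = {{}}"
    using finite_subset[of _ "{..<k}"] by auto
  ultimately show ?thesis by (simp add: answer_prob_def)
qed

text \<open>At half masses the two branches of the \<open>if\<close> agree, so a summand does not
  depend on \<open>J\<close>, and the inner sum merely counts the \<open>k choose a\<close>
  sets.\<close>

lemma answer_prob_half:
  "answer_prob (\<lambda>s. measure \<mu> (cell s) / 2) a = pmf (binomial_pmf k (1 / 2)) a * measure Q (consistent k n A x)"
proof -
  have "answer_prob (\<lambda>s. measure \<mu> (cell s) / 2) a
    = (\<Sum>s\<in>patterns. \<Sum>J | J \<subseteq> {..<k} \<and> card J = a. (\<Prod>i<k. measure \<mu> (cell (s i))) / 2 ^ k)"
    unfolding answer_prob_def
  proof (intro sum.cong refl)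
    fix s :: "nat \<Rightarrow> nat set" and J :: "nat set"
    have "(\<Prod>i<k. if i \<in> J then measure \<mu> (cell (s i)) / 2 else measure \<mu> (cell (s i)) - measure \<mu> (cell (s i)) / 2)
      = (\<Prod>i<k. measure \<mu> (cell (s i)) / 2)"
      by (intro prod.cong) auto
    also have "\<dots> = (\<Prod>i<k. measure \<mu> (cell (s i))) / 2 ^ k"
      by (simp add: prod_dividef)
    finally show "(\<Prod>i<k. if i \<in> J then measure \<mu> (cell (s i)) / 2 else measure \<mu> (cell (s i)) - measure \<mu> (cell (s i)) / 2)
      = \<dots>" .
  qed
  also have "\<dots> = real (k choose a) * ((\<Sum>s\<in>patterns. \<Prod>i<k. measure \<mu> (cell (s i))) / 2 ^ k)"
    using n_subsets[of "{..<k}" a] by (simp add: sum_divide_distrib sum_distrib_left)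
  also have "\<dots> = pmf (binomial_pmf k (1 / 2)) a * measure Q (consistent k n A x)"
    by (simp only: binomial_half_pmf measure_consistent) (simp add: field_simps)
  finally show ?thesis .
qed

text \<open>Cells are disjoint, so a piece of the right mass can be chosen in each one separately.
  The union runs over \<open>Pow {1..n}\<close> to be finite; every other cell is empty.\<close>

lemma exists_question_with_masses:
  assumes y: "\<And>s. 0 \<le> y s" "\<And>s. y s \<le> measure \<mu> (cell s)"
  obtains B where "B \<in> sets borel" "\<And>s. measure \<mu> (cell s \<inter> B) = y s"
proof -
  have "\<exists>D. D \<in> sets borel \<and> D \<subseteq> cell s \<and> measure \<mu> D = y s" for s
    unfolding \<mu>_def using prob_f0 cell_borel y by (intro exists_subset_of_measure) (auto simp: \<mu>_def)
  then obtain D where D: "\<And>s. D s \<in> sets borel" "\<And>s. D s \<subseteq> cell s" "\<And>s. measure \<mu> (D s) = y s"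
    by metis
  show thesis
  proof
    show "(\<Union>s\<in>Pow {1..n}. D s) \<in> sets borel" using D by (intro sets.finite_UN) auto
    fix s
    have "cell s \<inter> (\<Union>s\<in>Pow {1..n}. D s) = D s"
    proof (cases "s \<subseteq> {1..n}")
      case True
      then show ?thesis using D(2) by (fastforce simp: cell_def)
    next
      case False
      then show ?thesis using cell_empty D(2)[of s] by simp
    qed
    then show "measure \<mu> (cell s \<inter> (\<Union>s\<in>Pow {1..n}. D s)) = y s" using D by simp
  qed
qed

text \<open>The Shannon entropy of the next answer under the posterior, for a question that takes
  mass \<open>y s\<close> from \<open>cell s\<close>.\<close>

definition information :: "(nat set \<Rightarrow> real) \<Rightarrow> real" where
  "information y = - (\<Sum>a\<le>k. (answer_prob y a / measure Q (consistent k n A x))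
      * log 2 (answer_prob y a / measure Q (consistent k n A x)))"

lemma answer_prob_nonneg:
  assumes "\<And>s. 0 \<le> y s" "\<And>s. y s \<le> measure \<mu> (cell s)"
  shows "0 \<le> answer_prob y a"
  unfolding answer_prob_def using assms by (intro sum_nonneg prod_nonneg) auto

lemma continuous_on_answer_prob: "continuous_on Y (\<lambda>y. answer_prob y a)"
proof -
  have "continuous_on Y (\<lambda>y. if i \<in> J then y (s i) else measure \<mu> (cell (s i)) - y (s i))"
    for s :: "nat \<Rightarrow> nat set" and i and J :: "nat set"
    using continuous_on_subset[OF continuous_on_product_coordinates subset_UNIV, of Y "s i"]
    by (cases "i \<in> J") (auto intro!: continuous_on_diff continuous_on_const)
  then show ?thesis
    unfolding answer_prob_def by (intro continuous_on_sum continuous_on_prod)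
qed

lemma continuous_on_information:
  "continuous_on {y. \<forall>s. y s \<in> {0..measure \<mu> (cell s)}} information"
proof -
  have "continuous_on {y. \<forall>s. y s \<in> {0..measure \<mu> (cell s)}}
    (\<lambda>y. (\<lambda>r. r * log 2 r) (answer_prob y a / measure Q (consistent k n A x)))" for a
  proof (rule continuous_on_compose2[OF continuous_on_xlog2x])
    show "continuous_on {y. \<forall>s. y s \<in> {0..measure \<mu> (cell s)}}
      (\<lambda>y. answer_prob y a / measure Q (consistent k n A x))"
      unfolding divide_inverse by (intro continuous_on_mult continuous_on_answer_prob continuous_on_const)
    show "(\<lambda>y. answer_prob y a / measure Q (consistent k n A x)) ` {y. \<forall>s. y s \<in> {0..measure \<mu> (cell s)}} \<subseteq> {0..}"
    proof (rule image_subsetI)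
      fix y assume "y \<in> {y. \<forall>s. y s \<in> {0..measure \<mu> (cell s)}}"
      then show "answer_prob y a / measure Q (consistent k n A x) \<in> {0..}"
        using answer_prob_nonneg[of y a] by (simp add: divide_nonneg_nonneg)
    qed
  qed
  then show ?thesis
    unfolding information_def by (intro continuous_on_minus continuous_on_sum)
qed

context
  assumes pos: "measure Q (consistent k n A x) > 0"
begin

lemma expected_next_entropy_eq_information:
  assumes "B \<in> sets borel"
  shows "expected_next_entropy k (posterior k f0 n A x) B
     = diff_entropy k (posterior k f0 n A x) - information (\<lambda>s. measure \<mu> (cell s \<inter> B))"
  using expected_next_entropy_posterior[OF A pos assms] measure_answer_event[OF assms]
  by (simp add: information_def)

lemma optimal_question_exists: "\<exists>B. optimal_question k (posterior k f0 n A x) B"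
proof -
  let ?K = "{y. \<forall>s. y s \<in> {0..measure \<mu> (cell s)}}"
  have "compact ?K" by (rule compact_product_Icc)
  moreover have "(\<lambda>s. 0) \<in> ?K" by simp
  then have "?K \<noteq> {}" by (metis empty_iff)
  ultimately have "\<exists>y\<in>?K. \<forall>y'\<in>?K. information y' \<le> information y"
    by (intro continuous_attains_sup continuous_on_information)
  then obtain y where y: "y \<in> ?K" "\<And>y'. y' \<in> ?K \<Longrightarrow> information y' \<le> information y"
    by (elim bexE) (rule that, assumption, drule bspec)
  then obtain B where B: "B \<in> sets borel" "\<And>s. measure \<mu> (cell s \<inter> B) = y s"
    using exists_question_with_masses[of y] by auto
  have "expected_next_entropy k (posterior k f0 n A x) B \<le> expected_next_entropy k (posterior k f0 n A x) B'"
    if B': "B' \<in> sets borel" for B'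
  proof -
    \<comment> \<open>Every Borel set has its mass vector in the box, so the maximum over the box
      dominates all competing questions.\<close>
    have "(\<lambda>s. measure \<mu> (cell s \<inter> B')) \<in> ?K"
      using cell_borel by (auto intro!: \<mu>.finite_measure_mono simp: sets_\<mu>)
    then show ?thesis using y(2) by (simp add: expected_next_entropy_eq_information B B')
  qed
  then show ?thesis using B(1) by (auto simp: optimal_question_def is_arg_min_def not_less)
qed

lemma optimal_question_information:
  assumes B: "optimal_question k (posterior k f0 n A x) B"
  shows "expected_next_entropy k (posterior k f0 n A x) B
    \<le> diff_entropy k (posterior k f0 n A x) - shannon_entropy (binomial_pmf k (1 / 2))"
proof -
  obtain H where H: "H \<in> sets borel" "\<And>s. measure \<mu> (cell s \<inter> H) = measure \<mu> (cell s) / 2"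
    using exists_question_with_masses[of "\<lambda>s. measure \<mu> (cell s) / 2"] by auto
  have "expected_next_entropy k (posterior k f0 n A x) B \<le> expected_next_entropy k (posterior k f0 n A x) H"
    using B H(1) by (auto simp: optimal_question_def is_arg_min_def not_less)
  also have "\<dots> = diff_entropy k (posterior k f0 n A x) - shannon_entropy (binomial_pmf k (1 / 2))"
    using pos by (simp add: expected_next_entropy_eq_information[OF H(1)] H(2) information_def
        answer_prob_half shannon_entropy_binomial del: pmf_binomial)
  finally show ?thesis .
qed

end

end

end

text \<open>The inner normalising constant cancels because it is nonzero. This identifies the next
  posterior of the one-step problem with the posterior of the longer history.\<close>

lemma cond_density_cond_density:
  assumes "(\<integral>v. p v * indicator S v \<partial>lebesgue_Rk k) \<noteq> 0"
  shows "cond_density k (cond_density k p S) T = cond_density k p (S \<inter> T)"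
proof
  fix u
  have "(\<integral>v. p v * indicator S v / c * indicator T v \<partial>lebesgue_Rk k)
     = (\<integral>v. p v * indicator (S \<inter> T) v \<partial>lebesgue_Rk k) / c" for c
    by (simp add: indicator_inter_arith mult.assoc flip: integral_divide_zero)
  then show "cond_density k (cond_density k p S) T u = cond_density k p (S \<inter> T) u"
    using assms by (simp add: cond_density_def indicator_inter_arith mult.assoc)
qed

section \<open>Histories of a policy\<close>

text \<open>The strip over \<open>{0..1}\<close> is measurable in the full product, so its
  measurable subsets are too. Working over all of \<open>borel\<close> matches the target space of
  \<open>Z\<close>.\<close>

lemma policy_sets_borel:
  assumes "is_policy k N \<pi>" "n \<in> {1..N}"
  shows "\<pi> n \<in> sets (borel \<Otimes>\<^sub>M ((\<Pi>\<^sub>M m\<in>{1..<n}. count_space {0..k}) \<Otimes>\<^sub>M borel))"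
proof -
  define R :: "((nat \<Rightarrow> nat) \<times> real) measure" where "R = (\<Pi>\<^sub>M m\<in>{1..<n}. count_space {0..k}) \<Otimes>\<^sub>M borel"
  let ?X = "{0..1} \<times> space R :: (real \<times> (nat \<Rightarrow> nat) \<times> real) set"
  have X: "?X \<in> sets (borel \<Otimes>\<^sub>M R)" by (intro pair_measureI) auto
  have spX: "?X \<inter> space (borel \<Otimes>\<^sub>M R) = ?X" by (auto simp: space_pair_measure)
  have \<pi>: "\<pi> n \<in> sets (restrict_space borel {0..1} \<Otimes>\<^sub>M R)"
    using assms by (simp add: is_policy_def R_def)
  have "(\<lambda>w. (fst w, snd w)) \<in> measurable (restrict_space (borel \<Otimes>\<^sub>M R) ?X) (restrict_space borel {0..1} \<Otimes>\<^sub>M R)"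
    by (intro measurable_Pair measurable_restrict_space2 measurable_restrict_space1)
      (auto simp: space_restrict_space)
  from measurable_sets[OF this \<pi>]
  have "\<pi> n \<inter> space (restrict_space (borel \<Otimes>\<^sub>M R) ?X) \<in> sets (restrict_space (borel \<Otimes>\<^sub>M R) ?X)"
    by simp
  moreover have "\<pi> n \<subseteq> space (restrict_space (borel \<Otimes>\<^sub>M R) ?X)"
    using sets.sets_into_space[OF \<pi>] by (auto simp: space_pair_measure space_restrict_space)
  ultimately have "\<pi> n \<in> sets (restrict_space (borel \<Otimes>\<^sub>M R) ?X)" by (simp add: Int_absorb2)
  then show ?thesis
    using X unfolding R_def[symmetric] by (simp add: sets_restrict_space_iff spX)
qed

lemma measurable_eq_finite_range:
  assumes f: "f \<in> measurable M (count_space X)" and g: "g \<in> measurable M (count_space X)" and X: "finite X"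
  shows "{w\<in>space M. f w = g w} \<in> sets M"
proof -
  have "{w\<in>space M. f w = g w} = (\<Union>x\<in>X. (f -` {x} \<inter> space M) \<inter> (g -` {x} \<inter> space M))"
    using measurable_space[OF g] by auto
  also have "\<dots> \<in> sets M"
    using X by (intro sets.finite_UN sets.Int measurable_sets[OF f] measurable_sets[OF g]) auto
  finally show ?thesis .
qed

text \<open>Only answers are recorded: for fixed \<open>z\<close> they determine the questions,
  which leaves finitely many histories.\<close>

definition history :: "nat \<Rightarrow> policy \<Rightarrow> nat \<Rightarrow> real \<Rightarrow> (nat \<Rightarrow> real) \<Rightarrow> nat \<Rightarrow> nat" where
  "history k \<pi> n z u = (\<lambda>m\<in>{1..n}. policy_answer k \<pi> z u m)"

definition histories :: "nat \<Rightarrow> nat \<Rightarrow> (nat \<Rightarrow> nat) set" where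
  "histories k n = {1..n} \<rightarrow>\<^sub>E {0..k}"

lemma finite_histories: "finite (histories k n)"
  by (simp add: histories_def finite_PiE)

lemma policy_question_history:
  "policy_question k \<pi> z u n = {t. (z, history k \<pi> (n - 1) z u, t) \<in> \<pi> n}"
proof -
  have "{1..<n} = {1..n - 1}" by auto
  then show ?thesis by (simp add: policy_question_def history_def)
qed

lemma policy_answer_question: "policy_answer k \<pi> z u n = answer k (policy_question k \<pi> z u n) u"
  by (subst policy_answer.simps) (simp add: policy_question_def)

lemma policy_answer_le: "policy_answer k \<pi> z u n \<le> k"
  by (simp add: policy_answer_question answer_le)

lemma history_in_histories: "history k \<pi> n z u \<in> histories k n"
  by (auto simp: history_def histories_def policy_answer_le)

lemma history_eq_iff:
  "history k \<pi> n z v = history k \<pi> n z u \<longleftrightarrow> (\<forall>m\<in>{1..n}. policy_answer k \<pi> z v m = policy_answer k \<pi> z u m)"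
  by (auto simp: history_def fun_eq_iff restrict_def)

text \<open>Points with equal histories are asked the same next question, so the histories remain
  equal exactly when the answers to it agree.\<close>

lemma history_eq_step:
  assumes "1 \<le> n" "history k \<pi> (n - 1) z v = history k \<pi> (n - 1) z u"
  shows "history k \<pi> n z v = history k \<pi> n z u \<longleftrightarrow>
    answer k (policy_question k \<pi> z u n) v = answer k (policy_question k \<pi> z u n) u"
proof -
  have "{1..n} = insert n {1..n - 1}" using assms(1) by auto
  moreover have "policy_answer k \<pi> z v n = answer k (policy_question k \<pi> z u n) v"
    using assms(2) by (simp add: policy_answer_question policy_question_history)
  ultimately show ?thesis
    using assms(2) by (auto simp: history_eq_iff policy_answer_question[of k \<pi> z u n])
qed

lemma history_eq_mono:
  "history k \<pi> n z v = history k \<pi> n z u \<Longrightarrow> m \<le> n \<Longrightarrow> history k \<pi> m z v = history k \<pi> m z u"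
  by (auto simp: history_eq_iff)

text \<open>The left side puts to \<open>v\<close> the questions chosen along the path of
  \<open>u\<close>. By induction, as long as the answers agree, these are also the questions on the
  path of \<open>v\<close>; the posterior thus conditions on a fibre of the history.\<close>

lemma consistent_policy:
  "consistent k n (policy_question k \<pi> z u) (policy_answer k \<pi> z u)
     = {v\<in>space (lebesgue_Rk k). history k \<pi> n z v = history k \<pi> n z u}"
proof (intro set_eqI)
  fix v
  have "(\<forall>m\<in>{1..n}. policy_answer k \<pi> z u m = answer k (policy_question k \<pi> z u m) v)
     \<longleftrightarrow> history k \<pi> n z v = history k \<pi> n z u"
  proof (induction n)
    case 0
    then show ?case by (simp add: history_eq_iff)
  next
    case (Suc n)
    have "{1..Suc n} = insert (Suc n) {1..n}" by auto
    then have "(\<forall>m\<in>{1..Suc n}. policy_answer k \<pi> z u m = answer k (policy_question k \<pi> z u m) v) \<longleftrightarrow>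
       history k \<pi> n z v = history k \<pi> n z u \<and>
       policy_answer k \<pi> z u (Suc n) = answer k (policy_question k \<pi> z u (Suc n)) v"
      using Suc by auto
    also have "\<dots> \<longleftrightarrow> history k \<pi> (Suc n) z v = history k \<pi> (Suc n) z u"
      using history_eq_step[of "Suc n" k \<pi> z v u] history_eq_mono[of k \<pi> "Suc n" z v u n]
      by (auto simp: policy_answer_question)
    finally show ?case .
  qed
  then show "v \<in> consistent k n (policy_question k \<pi> z u) (policy_answer k \<pi> z u) \<longleftrightarrow>
     v \<in> {v\<in>space (lebesgue_Rk k). history k \<pi> n z v = history k \<pi> n z u}"
    by (simp add: consistent_def)
qed

text \<open>Strong induction, since a question depends on all earlier answers. Measurability is
  joint in \<open>(z, u)\<close> because \<open>Z\<close> is integrated out at the end.\<close>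

lemma measurable_policy_answer:
  assumes \<pi>: "is_policy k N \<pi>"
  shows "n \<in> {1..N} \<Longrightarrow>
    (\<lambda>(z, u). policy_answer k \<pi> z u n) \<in> measurable (borel \<Otimes>\<^sub>M lebesgue_Rk k) (count_space {0..k})"
proof (induction n rule: less_induct)
  case (less n)
  have hist: "(\<lambda>w. \<lambda>m\<in>{1..<n}. policy_answer k \<pi> (fst w) (snd w) m)
      \<in> measurable (borel \<Otimes>\<^sub>M lebesgue_Rk k) (\<Pi>\<^sub>M m\<in>{1..<n}. count_space {0..k})"
    using less by (intro measurable_restrict) (auto simp: case_prod_beta)
  have coord: "(\<lambda>w. snd w i) \<in> measurable ((borel :: real measure) \<Otimes>\<^sub>M lebesgue_Rk k) borel" if "i < k" for i
    using that unfolding lebesgue_Rk_def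
    by (intro measurable_compose[OF measurable_snd] measurable_compose[OF measurable_component_singleton]) auto
  have ind: "(indicator (\<pi> n) :: _ \<Rightarrow> nat) \<in> measurable
      (borel \<Otimes>\<^sub>M ((\<Pi>\<^sub>M m\<in>{1..<n}. count_space {0..k}) \<Otimes>\<^sub>M borel)) (count_space UNIV)"
    unfolding indicator_def[abs_def] using policy_sets_borel[OF \<pi> less.prems] by measurable
  have "(\<lambda>w. \<Sum>i<k. indicator (\<pi> n)
        (fst w, (\<lambda>m\<in>{1..<n}. policy_answer k \<pi> (fst w) (snd w) m), snd w i) :: nat)
      \<in> measurable (borel \<Otimes>\<^sub>M lebesgue_Rk k) (count_space UNIV)"
    using hist coord
    by (intro measurable_sum_nat measurable_compose[OF _ ind] measurable_Pair measurable_fst) auto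
  moreover have "(\<Sum>i<k. indicator (\<pi> n)
        (z, (\<lambda>m\<in>{1..<n}. policy_answer k \<pi> z u m), u i)) = policy_answer k \<pi> z u n" for z u
    by (subst (2) policy_answer.simps) (simp add: answer_def indicator_def)
  ultimately have "(\<lambda>w. policy_answer k \<pi> (fst w) (snd w) n) \<in> measurable (borel \<Otimes>\<^sub>M lebesgue_Rk k) (count_space UNIV)"
    by simp
  then have "(\<lambda>w. policy_answer k \<pi> (fst w) (snd w) n) \<in> measurable (borel \<Otimes>\<^sub>M lebesgue_Rk k) (count_space {0..k})"
    by (rule measurable_count_space_extend[rotated 2]) (auto simp: policy_answer_le)
  then show ?case by (simp add: case_prod_beta')
qed

lemma measurable_history:
  assumes \<pi>: "is_policy k N \<pi>" and n: "n \<le> N"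
  shows "(\<lambda>w. history k \<pi> n (fst w) (snd w)) \<in> measurable (borel \<Otimes>\<^sub>M lebesgue_Rk k) (count_space (histories k n))"
proof -
  have "(\<lambda>w. \<lambda>m\<in>{1..n}. policy_answer k \<pi> (fst w) (snd w) m)
      \<in> measurable (borel \<Otimes>\<^sub>M lebesgue_Rk k) (\<Pi>\<^sub>M m\<in>{1..n}. count_space {0..k})"
    using measurable_policy_answer[OF \<pi>] n by (intro measurable_restrict) (auto simp: case_prod_beta')
  also have "(\<Pi>\<^sub>M m\<in>{1..n}. count_space {0..k}) = count_space (histories k n)"
    unfolding histories_def by (intro count_space_PiM_finite) auto
  finally show ?thesis by (simp only: history_def)
qed

lemma measurable_history_section:
  assumes "is_policy k N \<pi>" "n \<le> N"
  shows "history k \<pi> n z \<in> measurable (lebesgue_Rk k) (count_space (histories k n))"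
  using measurable_compose[OF measurable_Pair1'[of z borel "lebesgue_Rk k"] measurable_history[OF assms]] by simp

lemma policy_question_borel:
  assumes \<pi>: "is_policy k N \<pi>" and n: "n \<in> {1..N}"
  shows "policy_question k \<pi> z u n \<in> sets borel"
proof -
  have "(\<lambda>m\<in>{1..<n}. policy_answer k \<pi> z u m) \<in> space (\<Pi>\<^sub>M m\<in>{1..<n}. count_space {0..k})"
    by (auto simp: space_PiM policy_answer_le)
  then have "(\<lambda>t. (z, (\<lambda>m\<in>{1..<n}. policy_answer k \<pi> z u m), t))
     \<in> measurable borel (borel \<Otimes>\<^sub>M ((\<Pi>\<^sub>M m\<in>{1..<n}. count_space {0..k}) \<Otimes>\<^sub>M borel))"
    by (intro measurable_Pair measurable_const measurable_ident) auto
  from measurable_sets[OF this policy_sets_borel[OF \<pi> n]] show ?thesis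
    by (simp add: policy_question_def vimage_def)
qed

section \<open>Expected posterior entropy along a policy\<close>

context iid_prior
begin

context
  fixes \<pi> :: policy and N :: nat
  assumes \<pi>: "is_policy k N \<pi>"
begin

definition branch :: "nat \<Rightarrow> real \<Rightarrow> (nat \<Rightarrow> real) \<Rightarrow> (nat \<Rightarrow> real) set" where
  "branch n z u = {v\<in>space L. history k \<pi> n z v = history k \<pi> n z u}"

definition entropy_after :: "nat \<Rightarrow> real \<Rightarrow> (nat \<Rightarrow> real) \<Rightarrow> real" where
  "entropy_after n z u = diff_entropy k (policy_posterior k f0 \<pi> n z u)"

lemma policy_posterior_eq: "policy_posterior k f0 \<pi> n z u = cond_density k (prior_density k f0) (branch n z u)"
  by (simp add: policy_posterior_def posterior_def consistent_policy branch_def)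

lemma branch_sets: "n \<le> N \<Longrightarrow> branch n z u \<in> sets L"
  unfolding branch_def
  by (intro measurable_eq_finite_range[OF measurable_history_section[OF \<pi>] _ finite_histories])
    (auto simp: history_in_histories)

lemma entropy_after_eq:
  "n \<le> N \<Longrightarrow> entropy_after n z u = log 2 (measure Q (branch n z u)) - local_entropy (branch n z u) / measure Q (branch n z u)"
  unfolding entropy_after_def policy_posterior_eq by (intro diff_entropy_cond branch_sets)

text \<open>The pair \<open>(z, u)\<close> selects the branch and the last component runs over its
  points, so that integrals over a branch become measurable functions of
  \<open>(z, u)\<close>.\<close>

lemma measurable_branch_indicator:
  assumes "n \<le> N"
  shows "(\<lambda>w. indicator (branch n (fst (fst w)) (snd (fst w))) (snd w) :: real) \<in> borel_measurable ((borel \<Otimes>\<^sub>M L) \<Otimes>\<^sub>M L)"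
proof -
  have "{w\<in>space ((borel \<Otimes>\<^sub>M L) \<Otimes>\<^sub>M L). history k \<pi> n (fst (fst w)) (snd w) = history k \<pi> n (fst (fst w)) (snd (fst w))}
      \<in> sets ((borel \<Otimes>\<^sub>M L) \<Otimes>\<^sub>M L)" (is "?S \<in> _")
  proof (rule measurable_eq_finite_range[OF _ _ finite_histories])
    show "(\<lambda>w. history k \<pi> n (fst (fst w)) (snd w)) \<in> measurable ((borel \<Otimes>\<^sub>M L) \<Otimes>\<^sub>M L) (count_space (histories k n))"
      using measurable_compose[OF _ measurable_history[OF \<pi> assms], of "\<lambda>w. (fst (fst w), snd w)" "(borel \<Otimes>\<^sub>M L) \<Otimes>\<^sub>M L"]
      by simp
    show "(\<lambda>w. history k \<pi> n (fst (fst w)) (snd (fst w))) \<in> measurable ((borel \<Otimes>\<^sub>M L) \<Otimes>\<^sub>M L) (count_space (histories k n))"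
      by (rule measurable_compose[OF measurable_fst measurable_history[OF \<pi> assms]])
  qed
  then have "(indicator ?S :: _ \<Rightarrow> real) \<in> borel_measurable ((borel \<Otimes>\<^sub>M L) \<Otimes>\<^sub>M L)" by simp
  then show ?thesis
    by (rule measurable_cong[THEN iffD1, rotated]) (auto simp: indicator_def branch_def space_pair_measure)
qed

lemma measurable_branch_integral:
  fixes f :: "(real \<times> (nat \<Rightarrow> real)) \<times> (nat \<Rightarrow> real) \<Rightarrow> real"
  assumes n: "n \<le> N" and f: "f \<in> borel_measurable ((borel \<Otimes>\<^sub>M L) \<Otimes>\<^sub>M L)"
  shows "(\<lambda>w. \<integral>v. indicator (branch n (fst w) (snd w)) v * f (w, v) \<partial>L) \<in> borel_measurable (borel \<Otimes>\<^sub>M L)"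
proof -
  interpret sigma_finite_measure L by (rule sigma_finite_lebesgue_Rk)
  have "(\<lambda>w. indicator (branch n (fst (fst w)) (snd (fst w))) (snd w) * f w) \<in> borel_measurable ((borel \<Otimes>\<^sub>M L) \<Otimes>\<^sub>M L)"
    using measurable_branch_indicator[OF n] f by (rule borel_measurable_times)
  then show ?thesis
    by (intro borel_measurable_lebesgue_integral) (simp add: case_prod_beta')
qed

lemma measurable_branch_measure:
  assumes n: "n \<le> N"
  shows "(\<lambda>w. measure Q (branch n (fst w) (snd w))) \<in> borel_measurable (borel \<Otimes>\<^sub>M L)"
proof -
  have "(\<lambda>w. \<integral>v. indicator (branch n (fst w) (snd w)) v * prior_density k f0 (snd (w, v)) \<partial>L) \<in> borel_measurable (borel \<Otimes>\<^sub>M L)"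
    using measurable_branch_integral[OF n, of "\<lambda>w. prior_density k f0 (snd w)"] measurable_compose[OF measurable_snd q_measurable]
    by simp
  then show ?thesis
    using integral_q_indicator[OF branch_sets[OF n]] by (simp add: mult.commute)
qed

lemma measurable_entropy_after:
  assumes n: "n \<le> N"
  shows "(\<lambda>w. entropy_after n (fst w) (snd w)) \<in> borel_measurable (borel \<Otimes>\<^sub>M L)"
proof -
  have "(\<lambda>w. local_entropy (branch n (fst w) (snd w))) \<in> borel_measurable (borel \<Otimes>\<^sub>M L)"
    unfolding local_entropy_def
    using measurable_branch_integral[OF n, of "\<lambda>w. prior_density k f0 (snd w) * log 2 (prior_density k f0 (snd w))"]
      measurable_compose[OF measurable_snd, of "\<lambda>v. prior_density k f0 v * log 2 (prior_density k f0 v)" L borel "borel \<Otimes>\<^sub>M L"]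
    by simp
  then show ?thesis
    using measurable_branch_measure[OF n] by (simp add: entropy_after_eq[OF n])
qed

lemma measurable_entropy_after_section:
  assumes n: "n \<le> N"
  shows "entropy_after n z \<in> borel_measurable L"
  using measurable_compose[OF measurable_Pair1'[of z borel L] measurable_entropy_after[OF n]] by simp

text \<open>The conditional expectation of the next entropy given the history, as an average over
  the branch. In this form it is visibly measurable and fits the tower property.\<close>

definition mean_entropy_next :: "nat \<Rightarrow> real \<Rightarrow> (nat \<Rightarrow> real) \<Rightarrow> real" where
  "mean_entropy_next n z u =
     (\<integral>v. indicator (branch n z u) v * entropy_after (Suc n) z v \<partial>Q) / measure Q (branch n z u)"

lemma measurable_mean_entropy_next:
  assumes n: "Suc n \<le> N"
  shows "(\<lambda>w. mean_entropy_next n (fst w) (snd w)) \<in> borel_measurable (borel \<Otimes>\<^sub>M L)"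
proof -
  have n': "n \<le> N" using n by simp
  have "(\<lambda>w. prior_density k f0 (snd w) * entropy_after (Suc n) (fst (fst w)) (snd w)) \<in> borel_measurable ((borel \<Otimes>\<^sub>M L) \<Otimes>\<^sub>M L)"
    using measurable_compose[OF measurable_snd q_measurable]
      measurable_compose[OF _ measurable_entropy_after[OF n], of "\<lambda>w. (fst (fst w), snd w)" "(borel \<Otimes>\<^sub>M L) \<Otimes>\<^sub>M L"]
    by (intro borel_measurable_times) simp_all
  from measurable_branch_integral[OF n' this]
  have "(\<lambda>w. \<integral>v. indicator (branch n (fst w) (snd w)) v * (prior_density k f0 v * entropy_after (Suc n) (fst w) v) \<partial>L)
      \<in> borel_measurable (borel \<Otimes>\<^sub>M L)"
    by simp
  moreover have "(\<integral>v. indicator (branch n z u) v * (prior_density k f0 v * entropy_after (Suc n) z v) \<partial>L)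
     = (\<integral>v. indicator (branch n z u) v * entropy_after (Suc n) z v \<partial>Q)" for z u
    using branch_sets[OF n', of z u] measurable_entropy_after_section[OF n, of z]
    by (subst integral_Q) (auto simp: mult.left_commute)
  ultimately show ?thesis
    using measurable_branch_measure[OF n'] unfolding mean_entropy_next_def by simp
qed

text \<open>Outside the branch the posterior vanishes; inside it, conditioning the posterior on the
  next answer is conditioning the prior on the longer history.\<close>

lemma expected_next_entropy_policy:
  assumes n: "Suc n \<le> N" and pos: "measure Q (branch n z u) > 0"
  shows "expected_next_entropy k (policy_posterior k f0 \<pi> n z u) (policy_question k \<pi> z u (Suc n))
     = mean_entropy_next n z u"
proof -
  define c where "c = measure Q (branch n z u)"
  let ?q = "policy_posterior k f0 \<pi> n z u" and ?B = "policy_question k \<pi> z u (Suc n)"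
  let ?D = "\<lambda>t. diff_entropy k (cond_density k ?q {v \<in> space L. answer k ?B v = answer k ?B t})"
  have S[measurable]: "branch n z u \<in> sets L" using n by (intro branch_sets) simp
  have q: "?q v = prior_density k f0 v * indicator (branch n z u) v / c" for v
    unfolding policy_posterior_eq cond_density_def by (simp add: integral_q_indicator[OF S] c_def)
  have "?q = (\<lambda>v. prior_density k f0 v * indicator (branch n z u) v / c)" using q by (rule ext)
  then have q_meas: "?q \<in> borel_measurable L" by simp
  have B: "?B \<in> sets borel" using policy_question_borel[OF \<pi>] n by simp
  have D: "?D \<in> borel_measurable L"
    using measurable_compose[OF measurable_answer[OF B],
        where g="\<lambda>a. diff_entropy k (cond_density k ?q {v \<in> space L. answer k ?B v = a})" and L=borel]
    by simp
  have "?D t = entropy_after (Suc n) z t" if t: "t \<in> branch n z u" for t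
  proof -
    have "branch n z u \<inter> {v \<in> space L. answer k ?B v = answer k ?B t} = branch (Suc n) z t"
    proof (intro set_eqI)
      fix v
      have eq: "history k \<pi> n z t = history k \<pi> n z u" "policy_question k \<pi> z t (Suc n) = ?B"
        using t by (auto simp: branch_def policy_question_history)
      show "v \<in> branch n z u \<inter> {v \<in> space L. answer k ?B v = answer k ?B t} \<longleftrightarrow> v \<in> branch (Suc n) z t"
        using history_eq_step[of "Suc n" k \<pi> z v t] history_eq_mono[of k \<pi> "Suc n" z v t n] eq
        by (auto simp: branch_def)
    qed
    moreover have "(\<integral>v. prior_density k f0 v * indicator (branch n z u) v \<partial>L) \<noteq> 0"
      using pos integral_q_indicator[OF S] by simp
    ultimately show ?thesis
      by (simp add: entropy_after_def policy_posterior_eq cond_density_cond_density)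
  qed
  then have eq: "?q t * ?D t = prior_density k f0 t * (indicator (branch n z u) t * entropy_after (Suc n) z t) / c" for t
    by (cases "t \<in> branch n z u") (simp_all add: q)
  have "expected_next_entropy k ?q ?B = (\<integral>t. ?q t * ?D t \<partial>L)"
    unfolding expected_next_entropy_def using D q_meas q_nonneg
    by (subst integral_density) (auto simp: q c_def)
  also have "\<dots> = (\<integral>t. prior_density k f0 t * (indicator (branch n z u) t * entropy_after (Suc n) z t) \<partial>L) / c"
    by (simp add: eq)
  also have "\<dots> = mean_entropy_next n z u"
    unfolding mean_entropy_next_def c_def
    using measurable_entropy_after_section[OF n, of z]
    by (subst integral_Q) auto
  finally show ?thesis .
qed

lemma integrable_entropy_after: "n \<le> N \<Longrightarrow> integrable Q (entropy_after n z)"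
  and integral_abs_entropy_after: "n \<le> N \<Longrightarrow> (\<integral>u. \<bar>entropy_after n z u\<bar> \<partial>Q)
     \<le> (\<integral>u. \<bar>prior_density k f0 u * log 2 (prior_density k f0 u)\<bar> \<partial>L) + card (histories k n) / ln 2"
  using mean_entropy_partition[OF measurable_history_section[OF \<pi>] finite_histories, of n z]
    mean_abs_entropy_partition[OF measurable_history_section[OF \<pi>] finite_histories, of n z]
  by (simp_all add: has_bochner_integral_iff entropy_after_def[abs_def] policy_posterior_eq branch_def)

lemma mean_entropy_tower:
  assumes n: "Suc n \<le> N"
  shows "has_bochner_integral Q (mean_entropy_next n z) (\<integral>u. entropy_after (Suc n) z u \<partial>Q)"
proof -
  have "history k \<pi> n z \<in> measurable Q (count_space (histories k n))"
    using g_measurable_Q[OF measurable_history_section[OF \<pi>] finite_histories] n by simp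
  from tower_finite_partition[OF Q.prob_space_axioms this finite_histories integrable_entropy_after[OF n]]
  show ?thesis by (simp add: mean_entropy_next_def[abs_def] branch_def space_Q)
qed

text \<open>For fixed \<open>z\<close> there are finitely many branches, so those of mass zero form
  a null set together.\<close>

lemma AE_branch_pos:
  assumes n: "n \<le> N"
  shows "AE u in Q. measure Q (branch n z u) > 0"
proof -
  let ?C = "\<lambda>x. {v\<in>space L. history k \<pi> n z v = x}"
  have "AE u in Q. \<forall>x\<in>histories k n. measure Q (?C x) = 0 \<longrightarrow> u \<notin> ?C x"
  proof (intro AE_finite_allI finite_histories)
    fix x assume x: "x \<in> histories k n"
    show "AE u in Q. measure Q (?C x) = 0 \<longrightarrow> u \<notin> ?C x"
    proof (cases "measure Q (?C x) = 0")
      case True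
      have "?C x \<in> sets L" using fibre_sets[OF measurable_history_section[OF \<pi> n] finite_histories x] .
      then have "?C x \<in> null_sets Q" using True by (simp add: null_sets_def Q.emeasure_eq_measure sets_Q)
      then have "AE u in Q. u \<notin> ?C x" by (rule AE_not_in)
      then show ?thesis by eventually_elim simp
    qed simp
  qed
  then show ?thesis
  proof (rule AE_mp[OF _ AE_I2], intro impI)
    fix u assume "u \<in> space Q" and *: "\<forall>x\<in>histories k n. measure Q (?C x) = 0 \<longrightarrow> u \<notin> ?C x"
    then have "measure Q (branch n z u) \<noteq> 0"
      using history_in_histories[of k \<pi> n z u] by (auto simp: branch_def space_Q)
    then show "measure Q (branch n z u) > 0" by (simp add: zero_less_measure_iff)
  qed
qed

text \<open>Optimality of the next question need not be a measurable condition on \<open>(z, u)\<close>, so an almost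
  sure statement about it does not pass from \<open>M\<close> to the law of \<open>(Z, \<theta>)\<close>. The inequality \<open>gains\<close>
  that it implies is measurable.\<close>

definition gains :: "nat \<Rightarrow> real \<Rightarrow> (nat \<Rightarrow> real) \<Rightarrow> bool" where
  "gains n z u \<longleftrightarrow> (measure Q (branch n z u) > 0 \<longrightarrow>
     mean_entropy_next n z u \<le> entropy_after n z u - shannon_entropy (binomial_pmf k (1 / 2)))"

lemma gains_measurable:
  assumes n: "Suc n \<le> N"
  shows "Measurable.pred (borel \<Otimes>\<^sub>M L) (\<lambda>w. gains n (fst w) (snd w))"
proof -
  note [measurable] = measurable_mean_entropy_next[OF n] measurable_entropy_after[OF Suc_leD[OF n]]
    measurable_branch_measure[OF Suc_leD[OF n]]
  show ?thesis unfolding gains_def by measurable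
qed

lemma optimal_question_gains:
  assumes n: "Suc n \<le> N"
    and "optimal_question k (policy_posterior k f0 \<pi> n z u) (policy_question k \<pi> z u (Suc n))"
  shows "gains n z u"
  unfolding gains_def
proof
  assume pos: "measure Q (branch n z u) > 0"
  have "expected_next_entropy k (policy_posterior k f0 \<pi> n z u) (policy_question k \<pi> z u (Suc n))
     \<le> diff_entropy k (policy_posterior k f0 \<pi> n z u) - shannon_entropy (binomial_pmf k (1 / 2))"
    using assms pos policy_question_borel[OF \<pi>] unfolding policy_posterior_def
    by (intro optimal_question_information) (auto simp: consistent_policy branch_def)
  then show "mean_entropy_next n z u \<le> entropy_after n z u - shannon_entropy (binomial_pmf k (1 / 2))"
    using expected_next_entropy_policy[OF n pos] by (simp add: entropy_after_def)
qed

lemma integral_entropy_after_Suc: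
  assumes n: "Suc n \<le> N" and gains: "AE u in Q. gains n z u"
  shows "(\<integral>u. entropy_after (Suc n) z u \<partial>Q) \<le> (\<integral>u. entropy_after n z u \<partial>Q) - shannon_entropy (binomial_pmf k (1 / 2))"
proof -
  have n': "n \<le> N" using n by simp
  have "(\<integral>u. entropy_after (Suc n) z u \<partial>Q) = (\<integral>u. mean_entropy_next n z u \<partial>Q)"
    using mean_entropy_tower[OF n] by (simp add: has_bochner_integral_iff)
  also have "\<dots> \<le> (\<integral>u. entropy_after n z u - shannon_entropy (binomial_pmf k (1 / 2)) \<partial>Q)"
  proof (rule integral_mono_AE)
    show "integrable Q (mean_entropy_next n z)"
      using mean_entropy_tower[OF n] by (simp add: has_bochner_integral_iff)
    show "AE u in Q. mean_entropy_next n z u \<le> entropy_after n z u - shannon_entropy (binomial_pmf k (1 / 2))"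
      using gains AE_branch_pos[OF n', of z] by eventually_elim (simp add: gains_def)
  qed (use integrable_entropy_after[OF n'] in auto)
  also have "\<dots> = (\<integral>u. entropy_after n z u \<partial>Q) - shannon_entropy (binomial_pmf k (1 / 2))"
    using integrable_entropy_after[OF n'] by (simp add: Q.prob_space)
  finally show ?thesis .
qed

lemma entropy_after_0: "entropy_after 0 z u = diff_entropy k (prior_density k f0)"
proof -
  have "branch 0 z u = space L" by (simp add: branch_def history_eq_iff)
  moreover have "(\<integral>v. indicator (space L) v * (prior_density k f0 v * log 2 (prior_density k f0 v)) \<partial>L)
     = (\<integral>v. prior_density k f0 v * log 2 (prior_density k f0 v) \<partial>L)"
    by (intro Bochner_Integration.integral_cong) auto
  ultimately show ?thesis
    using Q.prob_space by (simp add: entropy_after_eq local_entropy_def diff_entropy_def space_Q)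
qed

lemma integral_entropy_after_le:
  assumes "\<forall>n<N. AE u in Q. gains n z u"
  shows "(\<integral>u. entropy_after N z u \<partial>Q) \<le> diff_entropy k (prior_density k f0) - real N * shannon_entropy (binomial_pmf k (1 / 2))"
proof -
  have "n \<le> N \<Longrightarrow> (\<integral>u. entropy_after n z u \<partial>Q) \<le> diff_entropy k (prior_density k f0) - real n * shannon_entropy (binomial_pmf k (1 / 2))" for n
  proof (induction n)
    case 0
    show ?case by (simp add: entropy_after_0 Q.prob_space)
  next
    case (Suc n)
    then show ?case using integral_entropy_after_Suc[of n z] assms by (simp add: algebra_simps)
  qed
  then show ?thesis by simp
qed

lemma expected_entropy_after_le:
  assumes "prob_space U" and sets_U: "sets U = sets borel"
    and gains: "\<forall>n<N. AE w in U \<Otimes>\<^sub>M Q. gains n (fst w) (snd w)"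
  shows "(\<integral>w. entropy_after N (fst w) (snd w) \<partial>(U \<Otimes>\<^sub>M Q))
     \<le> diff_entropy k (prior_density k f0) - real N * shannon_entropy (binomial_pmf k (1 / 2))"
proof -
  interpret U: prob_space U by fact
  interpret UQ: pair_prob_space U Q ..
  have sets: "sets (U \<Otimes>\<^sub>M Q) = sets (borel \<Otimes>\<^sub>M L)"
    by (intro sets_pair_measure_cong) (simp_all add: sets_U sets_Q)
  let ?C = "(\<integral>u. \<bar>prior_density k f0 u * log 2 (prior_density k f0 u)\<bar> \<partial>L) + card (histories k N) / ln 2"
  let ?b = "diff_entropy k (prior_density k f0) - real N * shannon_entropy (binomial_pmf k (1 / 2))"
  have meas: "(\<lambda>w. entropy_after N (fst w) (snd w)) \<in> borel_measurable (U \<Otimes>\<^sub>M Q)"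
    by (subst measurable_cong_sets[OF sets refl]) (rule measurable_entropy_after, simp)
  have meas_abs: "(\<lambda>z. \<integral>u. \<bar>entropy_after N z u\<bar> \<partial>Q) \<in> borel_measurable U"
    using meas by (intro Q.borel_measurable_lebesgue_integral) (simp add: case_prod_beta')
  have int: "integrable (U \<Otimes>\<^sub>M Q) (\<lambda>(z, u). entropy_after N z u)"
  proof (rule UQ.Fubini_integrable)
    \<comment> \<open>The bound \<open>?C\<close> does not depend on \<open>z\<close>, and
      \<open>U\<close> is finite.\<close>
    show "integrable U (\<lambda>z. \<integral>u. norm (case (z, u) of (z, u) \<Rightarrow> entropy_after N z u) \<partial>Q)"
      using integral_abs_entropy_after[of N] meas_abs
      by (intro U.integrable_const_bound[of _ ?C]) (auto intro!: AE_I2)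
  qed (use meas integrable_entropy_after in \<open>auto simp: case_prod_beta'\<close>)
  have "(\<integral>w. entropy_after N (fst w) (snd w) \<partial>(U \<Otimes>\<^sub>M Q)) = (\<integral>z. (\<integral>u. entropy_after N z u \<partial>Q) \<partial>U)"
    using UQ.integral_fst'[OF int] by (simp add: case_prod_beta')
  also have "\<dots> \<le> (\<integral>z. ?b \<partial>U)"
  proof (rule integral_mono_AE)
    show "integrable U (\<lambda>z. \<integral>u. entropy_after N z u \<partial>Q)"
      using UQ.integrable_fst'[OF int] by simp
    have "AE z in U. AE u in Q. gains n z u" if "n < N" for n
      using UQ.AE_pair[OF gains[rule_format, OF that]] by simp
    \<comment> \<open>The exceptional sets of \<open>z\<close> for the finitely many steps are
      merged, because the induction at fixed \<open>z\<close> uses all gains at once.\<close>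
    then have "AE z in U. \<forall>n\<in>{..<N}. AE u in Q. gains n z u"
      by (intro AE_finite_allI) auto
    then show "AE z in U. (\<integral>u. entropy_after N z u \<partial>Q) \<le> ?b"
      by eventually_elim (simp add: integral_entropy_after_le)
  qed simp
  also have "\<dots> = ?b" by (simp add: U.prob_space)
  finally show ?thesis .
qed

end

end

section \<open>The joint law of \<open>Z\<close> and \<open>\<theta>\<close>, and the final
  estimate\<close>

lemma distr_pair_indep_rvs:
  assumes "prob_space M" and ind: "indep_rvs M S X T Y"
  shows "distr M (S \<Otimes>\<^sub>M T) (\<lambda>\<omega>. (X \<omega>, Y \<omega>)) = distr M S X \<Otimes>\<^sub>M distr M T Y"
proof (rule pair_measure_eqI[symmetric])
  interpret prob_space M by fact
  have X[measurable]: "X \<in> measurable M S" and Y[measurable]: "Y \<in> measurable M T"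
    and indep: "indep_set {X -` A \<inter> space M | A. A \<in> sets S} {Y -` B \<inter> space M | B. B \<in> sets T}"
    using ind by (simp_all add: indep_rvs_def)
  show "sigma_finite_measure (distr M S X)" "sigma_finite_measure (distr M T Y)"
    using prob_space_distr[OF X] prob_space_distr[OF Y] prob_space_imp_sigma_finite by auto
  show "sets (distr M S X \<Otimes>\<^sub>M distr M T Y) = sets (distr M (S \<Otimes>\<^sub>M T) (\<lambda>\<omega>. (X \<omega>, Y \<omega>)))"
    by (auto intro: sets_pair_measure_cong)
  fix A B assume "A \<in> sets (distr M S X)" "B \<in> sets (distr M T Y)"
  then have A: "A \<in> sets S" and B: "B \<in> sets T" by simp_all
  have "prob ((X -` A \<inter> space M) \<inter> (Y -` B \<inter> space M)) = prob (X -` A \<inter> space M) * prob (Y -` B \<inter> space M)"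
    using A B by (intro indep_setD[OF indep]) auto
  moreover have "(X -` A \<inter> space M) \<inter> (Y -` B \<inter> space M) = (\<lambda>\<omega>. (X \<omega>, Y \<omega>)) -` (A \<times> B) \<inter> space M" by auto
  ultimately show "emeasure (distr M S X) A * emeasure (distr M T Y) B
     = emeasure (distr M (S \<Otimes>\<^sub>M T) (\<lambda>\<omega>. (X \<omega>, Y \<omega>))) (A \<times> B)"
    using A B by (simp add: emeasure_distr emeasure_eq_measure ennreal_mult'[symmetric])
qed

theorem theorem6:
  fixes k N :: nat and f0 :: "real \<Rightarrow> real"
    and M :: "'a measure" and Z :: "'a \<Rightarrow> real" and \<theta> :: "'a \<Rightarrow> nat \<Rightarrow> real"
  assumes "k \<ge> 1" and "N \<ge> 1"
    and "prob_space M"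
    and "f0 \<in> borel_measurable borel" and "\<And>x. f0 x \<ge> 0"
    and "\<And>i. i < k \<Longrightarrow> distributed M lborel (\<lambda>\<omega>. \<theta> \<omega> i) (\<lambda>x. ennreal (f0 x))"
    and "prob_space.indep_vars M (\<lambda>_. borel) (\<lambda>i \<omega>. \<theta> \<omega> i) {..<k}"
    and "distr M lborel Z = uniform_measure lborel {0..1}"
    and "indep_rvs M borel Z (lebesgue_Rk k) \<theta>"
    and "integrable (lebesgue_Rk k) (\<lambda>u. prior_density k f0 u * log 2 (prior_density k f0 u))"
  shows "(\<forall>n\<in>{1..N}. \<forall>A x.
            (\<forall>m\<in>{1..<n}. A m \<in> sets borel \<and> x m \<in> {0..k}) \<longrightarrow>
            measure (density (lebesgue_Rk k) (\<lambda>u. ennreal (prior_density k f0 u)))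
              (consistent k (n - 1) A x) > 0 \<longrightarrow>
            (\<exists>B. optimal_question k (posterior k f0 (n - 1) A x) B))
       \<and> (\<forall>\<pi>. greedy_policy k N f0 M Z \<theta> \<pi> \<longrightarrow>
            reduction_rate k N f0 M Z \<theta> \<pi> \<ge> shannon_entropy (binomial_pmf k (1 / 2)))"
proof -
  interpret prob_space M by fact
  have d: "distr M lborel (\<lambda>\<omega>. \<theta> \<omega> i) = density lborel (\<lambda>x. ennreal (f0 x))" if "i < k" for i
    using assms(6)[OF that] by (simp add: distributed_def)
  have \<theta>i: "(\<lambda>\<omega>. \<theta> \<omega> i) \<in> borel_measurable M" if "i < k" for i
    using assms(6)[OF that] by (simp add: distributed_def)
  have Z: "Z \<in> borel_measurable M" and \<theta>: "\<theta> \<in> measurable M (lebesgue_Rk k)"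
    using assms(9) by (simp_all add: indep_rvs_def)
  interpret iid_prior k f0
  proof (rule iid_prior.intro)
    have "prob_space (distr M lborel (\<lambda>\<omega>. \<theta> \<omega> 0))"
      using \<theta>i[of 0] assms(1) by (intro prob_space_distr) simp
    then show "prob_space (density lborel (\<lambda>x. ennreal (f0 x)))" using d[of 0] assms(1) by simp
  qed (use assms in auto)
  \<comment> \<open>The values of \<open>\<theta>\<close> are extensional, being points of
    \<open>lebesgue_Rk k\<close>, so \<open>\<theta>\<close> equals the tuple of its coordinates,
    and independence of these makes its law a product.\<close>
  have "distr M (lebesgue_Rk k) \<theta> = distr M (\<Pi>\<^sub>M i\<in>{..<k}. borel) (\<lambda>\<omega>. \<lambda>i\<in>{..<k}. \<theta> \<omega> i)"
  proof (rule distr_cong)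
    fix \<omega> assume "\<omega> \<in> space M"
    then have "\<theta> \<omega> \<in> {..<k} \<rightarrow>\<^sub>E UNIV" using measurable_space[OF \<theta>] by (simp add: space_lebesgue_Rk)
    then show "\<theta> \<omega> = (\<lambda>i\<in>{..<k}. \<theta> \<omega> i)" by (simp add: PiE_restrict)
  qed (simp_all add: sets_lebesgue_Rk)
  also have "\<dots> = (\<Pi>\<^sub>M i\<in>{..<k}. distr M borel (\<lambda>\<omega>. \<theta> \<omega> i))"
    using assms(1,7) \<theta>i by (subst indep_vars_iff_distr_eq_PiM'[symmetric]) (auto simp: lessThan_empty_iff)
  also have "\<dots> = (\<Pi>\<^sub>M i\<in>{..<k}. \<mu>)"
  proof (rule PiM_cong[OF refl])
    fix i assume "i \<in> {..<k}"
    moreover have "distr M borel (\<lambda>\<omega>. \<theta> \<omega> i) = distr M lborel (\<lambda>\<omega>. \<theta> \<omega> i)" by (rule distr_cong) auto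
    ultimately show "distr M borel (\<lambda>\<omega>. \<theta> \<omega> i) = \<mu>" using d[of i] by (simp add: \<mu>_def)
  qed
  finally have distr_\<theta>: "distr M L \<theta> = Q" by (simp add: Q_eq_PiM)
  define U where "U = distr M borel Z"
  have U: "prob_space U" "sets U = sets borel" unfolding U_def using Z by (auto intro: prob_space_distr)
  have ZT: "(\<lambda>\<omega>. (Z \<omega>, \<theta> \<omega>)) \<in> measurable M (borel \<Otimes>\<^sub>M L)" using Z \<theta> by simp
  have joint: "distr M (borel \<Otimes>\<^sub>M L) (\<lambda>\<omega>. (Z \<omega>, \<theta> \<omega>)) = U \<Otimes>\<^sub>M Q"
    using distr_pair_indep_rvs[OF assms(3,9)] by (simp add: U_def distr_\<theta>)
  have "reduction_rate k N f0 M Z \<theta> \<pi> \<ge> shannon_entropy (binomial_pmf k (1 / 2))"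
    if greedy: "greedy_policy k N f0 M Z \<theta> \<pi>" for \<pi>
  proof -
    have \<pi>: "is_policy k N \<pi>" using greedy by (simp add: greedy_policy_def)
    have opt: "AE \<omega> in M. \<forall>n\<in>{1..N}. optimal_question k (policy_posterior k f0 \<pi> (n - 1) (Z \<omega>) (\<theta> \<omega>))
          (policy_question k \<pi> (Z \<omega>) (\<theta> \<omega>) n)"
      using greedy by (simp add: greedy_policy_def)
    have "AE w in U \<Otimes>\<^sub>M Q. gains \<pi> n (fst w) (snd w)" if n: "n < N" for n
    proof -
      have "AE \<omega> in M. gains \<pi> n (Z \<omega>) (\<theta> \<omega>)"
        using opt
      proof eventually_elim
        \<comment> \<open>Indices shift by one: the gain after \<open>n\<close> answers comes from
          question \<open>Suc n\<close>.\<close>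
        case (elim \<omega>)
        then show ?case using n by (intro optimal_question_gains[OF \<pi>]) (auto dest: bspec[of _ _ "Suc n"])
      qed
      then show ?thesis
        unfolding joint[symmetric] using gains_measurable[OF \<pi>, of n] n ZT
        by (subst AE_distr_iff) (auto simp: pred_def)
    qed
    then have "(\<integral>w. entropy_after \<pi> N (fst w) (snd w) \<partial>(U \<Otimes>\<^sub>M Q))
       \<le> diff_entropy k (prior_density k f0) - real N * shannon_entropy (binomial_pmf k (1 / 2))"
      using U by (intro expected_entropy_after_le[OF \<pi>]) auto
    also have "(\<integral>w. entropy_after \<pi> N (fst w) (snd w) \<partial>(U \<Otimes>\<^sub>M Q))
       = (\<integral>\<omega>. diff_entropy k (policy_posterior k f0 \<pi> N (Z \<omega>) (\<theta> \<omega>)) \<partial>M)"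
      unfolding joint[symmetric] using measurable_entropy_after[OF \<pi>, of N]
      by (subst integral_distr[OF ZT]) (auto simp: entropy_after_def[OF \<pi>])
    finally show ?thesis
      using assms(2) by (simp add: reduction_rate_def field_simps)
  qed
  moreover have "\<exists>B. optimal_question k (posterior k f0 (n - 1) A x) B"
    if "n \<in> {1..N}" "\<forall>m\<in>{1..<n}. A m \<in> sets borel \<and> x m \<in> {0..k}"
      "measure (density (lebesgue_Rk k) (\<lambda>u. ennreal (prior_density k f0 u))) (consistent k (n - 1) A x) > 0" for n A x
    using that by (intro optimal_question_exists) (auto simp: Q_def)
  ultimately show ?thesis by blast
qed

end
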